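(* Let $M$ be a smooth manifold. If $S$ is a spray on $M$, then its complete lift $S^c$ is a spray on $TM$.
   Context: $M$ is a real $C^\infty$ manifold of dimension $n$; all objects are smooth. $T^0M=M$, $T^rM=T(T^{r-1}M)$, $\pi_r\colon T^{r+1}M\to T^rM$ is the canonical projection, $D$ is the tangent map. Induced local coordinates on $TM$, $TTM$ are $(x,y)$, $(x,y,X,Y)$. $TM\setminus\{0\}=\{(x,y):y\neq0\}$ and $TTM\setminus\{0\}=\{(x,y,X,Y):X\ne0\}$. For $r\ge2$, $\kappa_r\colon T^rM\to T^rM$ is the unique diffeomorphism with $\partial_t\partial_sc(t,s)=\kappa_r\partial_s\partial_tc(t,s)$ for every map $c\colon(-\varepsilon,\varepsilon)^2\to T^{r-2}M$ (derivatives regarded as maps into iterated tangent bundles); in coordinates $\kappa_2(x,y,X,Y)=(x,X,y,Y)$ and $\kappa_3(x,y,X,Y,u,v,U,V)=(x,y,u,v,X,Y,U,V)$. For $r\in\{1,2\}$, a semispray on $T^{r-1}M$ is a vector field $S\in\mathfrak{X}(T^rM\setminus\{0\})$ with $\kappa_{r+1}\circ S=S$. The Liouville vector field $\mathbb{C}_r\in\mathfrak{X}(T^rM)$ is $\mathbb{C}_r(\xi)=\partial_s(\xi+s\xi)|_{s=0}$ (fibrewise operations with respect to $\pi_{r-1}$); in coordinates $\mathbb{C}_1=y^i\frac{\partial}{\partial y^i}$ and $\mathbb{C}_2=X^i\frac{\partial}{\partial X^i}+Y^i\frac{\partial}{\partial Y^i}$. A spray on $T^{r-1}M$ is a semispray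 $S$ on $T^{r-1}M$ that is $2$-homogeneous, i.e. $[\mathbb{C}_r,S]=S$. The complete lift of a semispray $S$ on $M$ is the vector field $S^c=D\kappa_2\circ\kappa_3\circ DS\circ\kappa_2$ on $TTM\setminus\{0\}$. *)

theory Defs
  imports "HOL-Analysis.Analysis"
begin

section \<open>Smooth maps between open subsets of Euclidean spaces\<close>

text \<open>Meant for open \<open>A\<close>; all iterated directional derivatives exist and are continuous.\<close>

fun continuously_differentiable_on ::
  "nat \<Rightarrow> 'e::euclidean_space set \<Rightarrow> ('e \<Rightarrow> 'f::euclidean_space) \<Rightarrow> bool" where
  "continuously_differentiable_on 0 A f \<longleftrightarrow> continuous_on A f"
| "continuously_differentiable_on (Suc k) A f \<longleftrightarrow>
     (\<forall>x\<in>A. f differentiable (at x)) \<and>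
     (\<forall>v. continuously_differentiable_on k A (\<lambda>x. frechet_derivative f (at x) v))"

definition smooth_on ::
  "'e::euclidean_space set \<Rightarrow> ('e \<Rightarrow> 'f::euclidean_space) \<Rightarrow> bool" where
  "smooth_on A f \<longleftrightarrow> (\<forall>k. continuously_differentiable_on k A f)"


section \<open>Smooth manifolds\<close>

datatype ('a, 'e) chart = Chart (chart_dom: "'a set") (coord: "'a \<Rightarrow> 'e")

definition coord_inv :: "('a, 'e) chart \<Rightarrow> 'e \<Rightarrow> 'a" where
  "coord_inv c = the_inv_into (chart_dom c) (coord c)"

text \<open>
  A manifold is given by an atlas (not necessarily maximal) and, for every point \<open>p\<close>, a preferred
  chart \<open>chart_at M p\<close> around \<open>p\<close>. The preferred charts carry no geometric information: they only
  fix how tangent vectors at \<open>p\<close> are encoded, see \<open>tangent_bundle\<close> below.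
\<close>

datatype ('a, 'e) manifold =
  Manifold (atlas: "('a, 'e) chart set") (chart_at: "'a \<Rightarrow> ('a, 'e) chart")

definition points :: "('a, 'e) manifold \<Rightarrow> 'a set" where
  "points M = (\<Union>c\<in>atlas M. chart_dom c)"

definition manifold_topology :: "('a, 'e::euclidean_space) manifold \<Rightarrow> 'a topology" where
  "manifold_topology M =
     topology (\<lambda>W. W \<subseteq> points M \<and> (\<forall>c\<in>atlas M. open (coord c ` (W \<inter> chart_dom c))))"

definition smooth_manifold :: "('a, 'e::euclidean_space) manifold \<Rightarrow> bool" where
  "smooth_manifold M \<longleftrightarrow>
     (\<forall>c\<in>atlas M. inj_on (coord c) (chart_dom c) \<and> open (coord c ` chart_dom c)) \<and>
     (\<forall>c\<in>atlas M. \<forall>d\<in>atlas M.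
        open (coord c ` (chart_dom c \<inter> chart_dom d)) \<and>
        smooth_on (coord c ` (chart_dom c \<inter> chart_dom d)) (coord d \<circ> coord_inv c)) \<and>
     (\<forall>p\<in>points M. chart_at M p \<in> atlas M \<and> p \<in> chart_dom (chart_at M p)) \<and>
     Hausdorff_space (manifold_topology M) \<and>
     second_countable (manifold_topology M)"

text \<open>
  \<open>smooth_map M U N f\<close>: \<open>f\<close> is a smooth map from the open subset \<open>U\<close> of \<open>M\<close> to \<open>N\<close>.
  Openness of \<open>U\<close> is implied, since the sets \<open>{p \<in> U \<inter> chart_dom c. f p \<in> chart_dom d}\<close>
  cover \<open>U\<close>. Values of \<open>f\<close> outside \<open>U\<close> are irrelevant.
\<close>

definition smooth_map ::
  "('a, 'e::euclidean_space) manifold \<Rightarrow> 'a set \<Rightarrow> ('b, 'f::euclidean_space) manifold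
    \<Rightarrow> ('a \<Rightarrow> 'b) \<Rightarrow> bool" where
  "smooth_map M U N f \<longleftrightarrow>
     U \<subseteq> points M \<and> f ` U \<subseteq> points N \<and>
     (\<forall>c\<in>atlas M. \<forall>d\<in>atlas N.
        let W = coord c ` {p \<in> U \<inter> chart_dom c. f p \<in> chart_dom d}
        in open W \<and> smooth_on W (coord d \<circ> f \<circ> coord_inv c))"

definition diffeomorphism ::
  "('a, 'e::euclidean_space) manifold \<Rightarrow> ('b, 'f::euclidean_space) manifold
    \<Rightarrow> ('a \<Rightarrow> 'b) \<Rightarrow> bool" where
  "diffeomorphism M N f \<longleftrightarrow>
     bij_betw f (points M) (points N) \<and>
     smooth_map M (points M) N f \<and>
     smooth_map N (points N) M (the_inv_into (points M) f)"

definition euclidean_manifold :: "('e::euclidean_space, 'e) manifold" where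
  "euclidean_manifold = Manifold {Chart UNIV id} (\<lambda>_. Chart UNIV id)"


section \<open>The tangent bundle\<close>

text \<open>
  The pair \<open>(p, v)\<close> encodes the tangent vector at \<open>p\<close> whose components with respect to
  \<open>chart_at M p\<close> are \<open>v\<close>. An arbitrary chart \<open>c\<close> induces the chart \<open>tangent_chart M c\<close>, i.e. the
  coordinates \<open>(x, y)\<close> where \<open>y\<close> are the components with respect to \<open>c\<close>. The preferred chart of
  the tangent bundle at \<open>(p, v)\<close> is the one induced by \<open>chart_at M p\<close>, so that a point of the
  second tangent bundle has the form \<open>((p, y), (X, Y))\<close>, where \<open>(x, y, X, Y)\<close> are its induced
  coordinates for the chart \<open>chart_at M p\<close> and \<open>x = coord (chart_at M p) p\<close>.
\<close>

definition tangent_chart ::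
  "('a, 'e::euclidean_space) manifold \<Rightarrow> ('a, 'e) chart \<Rightarrow> ('a \<times> 'e, 'e \<times> 'e) chart" where
  "tangent_chart M c = Chart (chart_dom c \<times> UNIV)
     (\<lambda>(p, v). (coord c p,
        frechet_derivative (coord c \<circ> coord_inv (chart_at M p)) (at (coord (chart_at M p) p)) v))"

definition tangent_bundle ::
  "('a, 'e::euclidean_space) manifold \<Rightarrow> ('a \<times> 'e, 'e \<times> 'e) manifold" where
  "tangent_bundle M =
     Manifold (tangent_chart M ` atlas M) (\<lambda>(p, v). tangent_chart M (chart_at M p))"

definition tangent_map ::
  "('a, 'e::euclidean_space) manifold \<Rightarrow> ('b, 'f::euclidean_space) manifold
    \<Rightarrow> ('a \<Rightarrow> 'b) \<Rightarrow> 'a \<times> 'e \<Rightarrow> 'b \<times> 'f" where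
  "tangent_map M N f = (\<lambda>(p, v).
     (f p, frechet_derivative (coord (chart_at N (f p)) \<circ> f \<circ> coord_inv (chart_at M p))
             (at (coord (chart_at M p) p)) v))"

definition velocity ::
  "('a, 'e::euclidean_space) manifold \<Rightarrow> (real \<Rightarrow> 'a) \<Rightarrow> real \<Rightarrow> 'a \<times> 'e" where
  "velocity M c t = (c t, vector_derivative (coord (chart_at M (c t)) \<circ> c) (at t))"

definition slit_tangent_bundle :: "('a, 'e::euclidean_space) manifold \<Rightarrow> ('a \<times> 'e) set" where
  "slit_tangent_bundle M = {(p, y). p \<in> points M \<and> y \<noteq> 0}"

text \<open>
  Only \<open>X \<noteq> 0\<close> is required; this is smaller than the complement of the zero section of the
  second tangent bundle.
\<close>

definition slit_second_tangent_bundle ::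
  "('a, 'e::euclidean_space) manifold \<Rightarrow> (('a \<times> 'e) \<times> ('e \<times> 'e)) set" where
  "slit_second_tangent_bundle M = {((p, y), (X, Y)). p \<in> points M \<and> X \<noteq> 0}"


section \<open>The canonical flip\<close>

text \<open>
  \<open>\<kappa>\<^sub>r\<close> on the \<open>r\<close>-th tangent bundle of \<open>M\<close> is \<open>canonical_flip N\<close> for \<open>N\<close> the \<open>(r - 2)\<close>-nd
  iterated tangent bundle of \<open>M\<close>. Extensionality fixes the values outside the bundle and
  makes the description definite.
\<close>

definition canonical_flip ::
  "('a, 'e::euclidean_space) manifold
    \<Rightarrow> ('a \<times> 'e) \<times> ('e \<times> 'e) \<Rightarrow> ('a \<times> 'e) \<times> ('e \<times> 'e)" where
  "canonical_flip N = (THE k.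
     k \<in> extensional (points (tangent_bundle (tangent_bundle N))) \<and>
     diffeomorphism (tangent_bundle (tangent_bundle N)) (tangent_bundle (tangent_bundle N)) k \<and>
     (\<forall>\<epsilon> c. \<epsilon> > 0 \<longrightarrow>
        smooth_map euclidean_manifold ({-\<epsilon><..<\<epsilon>} \<times> {-\<epsilon><..<\<epsilon>}) N c \<longrightarrow>
        (\<forall>t\<in>{-\<epsilon><..<\<epsilon>}. \<forall>s\<in>{-\<epsilon><..<\<epsilon>}.
           velocity (tangent_bundle N) (\<lambda>t. velocity N (\<lambda>s. c (t, s)) s) t =
           k (velocity (tangent_bundle N) (\<lambda>s. velocity N (\<lambda>t. c (t, s)) t) s))))"


section \<open>Vector fields, sprays and complete lifts\<close>

definition vector_field_on ::
  "('a, 'e::euclidean_space) manifold \<Rightarrow> 'a set \<Rightarrow> ('a \<Rightarrow> 'a \<times> 'e) \<Rightarrow> bool" where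
  "vector_field_on M U V \<longleftrightarrow> smooth_map M U (tangent_bundle M) V \<and> (\<forall>p\<in>U. fst (V p) = p)"

definition components ::
  "('a, 'e::euclidean_space) manifold \<Rightarrow> ('a, 'e) chart \<Rightarrow> ('a \<Rightarrow> 'a \<times> 'e) \<Rightarrow> 'e \<Rightarrow> 'e" where
  "components M c V x = snd (coord (tangent_chart M c) (V (coord_inv c x)))"

text \<open>
  The local formula \<open>[V, W]\<^sup>i = V\<^sup>j \<partial>\<^sub>j W\<^sup>i - W\<^sup>j \<partial>\<^sub>j V\<^sup>i\<close>, in the preferred chart at the given point.
\<close>

definition lie_bracket ::
  "('a, 'e::euclidean_space) manifold \<Rightarrow> ('a \<Rightarrow> 'a \<times> 'e) \<Rightarrow> ('a \<Rightarrow> 'a \<times> 'e) \<Rightarrow> 'a \<Rightarrow> 'a \<times> 'e"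
  where
  "lie_bracket M V W p =
     (let c = chart_at M p; x = coord c p; v = components M c V; w = components M c W
      in (p, frechet_derivative w (at x) (v x) - frechet_derivative v (at x) (w x)))"

text \<open>\<open>\<xi> + s \<xi>\<close> is formed in the fibre over \<open>fst \<xi>\<close>.\<close>

definition liouville ::
  "('a, 'e::euclidean_space) manifold \<Rightarrow> 'a \<times> 'e \<Rightarrow> ('a \<times> 'e) \<times> ('e \<times> 'e)" where
  "liouville N \<xi> = velocity (tangent_bundle N) (\<lambda>s. (fst \<xi>, snd \<xi> + s *\<^sub>R snd \<xi>)) 0"

text \<open>
  Below, \<open>U\<close> is the slit bundle on which the (semi)spray on \<open>N\<close> is defined: for \<open>N = M\<close> it is
  \<open>slit_tangent_bundle M\<close>, and for \<open>N = tangent_bundle M\<close> it is \<open>slit_second_tangent_bundle M\<close>.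
\<close>

definition semispray ::
  "('a, 'e::euclidean_space) manifold \<Rightarrow> ('a \<times> 'e) set
    \<Rightarrow> ('a \<times> 'e \<Rightarrow> ('a \<times> 'e) \<times> ('e \<times> 'e)) \<Rightarrow> bool" where
  "semispray N U S \<longleftrightarrow>
     vector_field_on (tangent_bundle N) U S \<and> (\<forall>\<xi>\<in>U. canonical_flip N (S \<xi>) = S \<xi>)"

definition spray ::
  "('a, 'e::euclidean_space) manifold \<Rightarrow> ('a \<times> 'e) set
    \<Rightarrow> ('a \<times> 'e \<Rightarrow> ('a \<times> 'e) \<times> ('e \<times> 'e)) \<Rightarrow> bool" where
  "spray N U S \<longleftrightarrow>
     semispray N U S \<and>
     (\<forall>\<xi>\<in>U. lie_bracket (tangent_bundle N) (liouville N) S \<xi> = S \<xi>)"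

text \<open>
  \<open>D \<kappa>\<^sub>2 \<circ> \<kappa>\<^sub>3 \<circ> D S \<circ> \<kappa>\<^sub>2\<close>; only its values on \<open>slit_second_tangent_bundle M\<close> are meaningful.
\<close>

definition complete_lift ::
  "('a, 'e::euclidean_space) manifold
    \<Rightarrow> ('a \<times> 'e \<Rightarrow> ('a \<times> 'e) \<times> ('e \<times> 'e))
    \<Rightarrow> ('a \<times> 'e) \<times> ('e \<times> 'e)
    \<Rightarrow> (('a \<times> 'e) \<times> ('e \<times> 'e)) \<times> (('e \<times> 'e) \<times> ('e \<times> 'e))" where
  "complete_lift M S =
     (let TM = tangent_bundle M; TTM = tangent_bundle TM
      in tangent_map TTM TTM (canonical_flip M) \<circ> canonical_flip TM \<circ>
         tangent_map TM TTM S \<circ> canonical_flip M)"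

end

theory Submission
  imports Defs
begin

text \<open>
  Since the preferred chart at a tangent vector only depends on its base point, the canonical flip is
  \<open>((p, y), (X, Y)) \<mapsto> ((p, X), (y, Y))\<close> in the encoding of the second tangent bundle; that this is
  compatible with all charts is the symmetry of second derivatives. If \<open>w (x, y) = (y, G (x, y))\<close> are
  the components of \<open>S\<close> in a chart, then those of the complete lift are
  \<open>flip \<circ> T w \<circ> flip\<close>, that is \<open>(x, y, X, Y) \<mapsto> (X, Y, G (x, X), D G (x, X) (y, Y))\<close>, where
  \<open>T w (z, v) = (w z, D w z v)\<close>. This is smooth and fixed by the flip, and the homogeneity of the lift is
  the derivative of the homogeneity equation of \<open>S\<close>.
\<close>

section \<open>Calculus of smooth maps between Euclidean spaces\<close>

text \<open>The flip is given by a definite description, so nothing can be computed with it before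
  existence and uniqueness are settled, and the same is needed one level up for
  \<open>\<kappa>\<^sub>3\<close>. The chart calculus is therefore built over
  \<open>smooth_atlas\<close>, a condition that passes from a manifold to its tangent bundle, so
  that each lemma about \<open>N\<close> can be read at M, TM or TTM. A second obstacle is that many
  values carry no information: \<open>coord_inv\<close> off the image of a chart,
  \<open>canonical_flip\<close> off the bundle, \<open>S\<close> off the slit bundle. Maps are
  compared with their coordinate formulas on open sets, and derivatives are taken only after such a
  comparison. The components \<open>w\<close> are kept as one map instead of the pair
  \<open>(y, G)\<close>. The semispray condition then reads \<open>fst (w z) = snd z\<close>, and
  2-homogeneity reads \<open>D w z (0, snd z) = w z + (0, snd (w z))\<close>. Both hold on an open
  set of a fixed chart, so both can be differentiated, which is how the lift inherits them.\<close>

lemma continuously_differentiable_on_subset: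
  "continuously_differentiable_on k A f \<Longrightarrow> B \<subseteq> A \<Longrightarrow> continuously_differentiable_on k B f"
  by (induction k arbitrary: f) (auto intro: continuous_on_subset)

lemma continuously_differentiable_on_cong:
  assumes "open A" "\<And>x. x \<in> A \<Longrightarrow> f x = g x" "continuously_differentiable_on k A f"
  shows "continuously_differentiable_on k A g"
  using assms(2,3)
proof (induction k arbitrary: f g)
  case 0
  then show ?case by (simp cong: continuous_on_cong)
next
  case (Suc k)
  have d: "(g has_derivative frechet_derivative f (at x)) (at x)" if "x \<in> A" for x
    using Suc.prems that \<open>open A\<close>
    by (auto simp: frechet_derivative_works intro!: has_derivative_transform_within_open[of f _ x UNIV A g])
  then have eq: "frechet_derivative g (at x) = frechet_derivative f (at x)" if "x \<in> A" for x
    using that by (metis frechet_derivative_at)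
  have "continuously_differentiable_on k A (\<lambda>x. frechet_derivative g (at x) v)" for v
    by (rule Suc.IH[of "\<lambda>x. frechet_derivative f (at x) v"]) (use Suc.prems eq in auto)
  with d show ?case by (auto simp: differentiable_def)
qed

text \<open>The successor clause refers to \<open>frechet_derivative\<close>; uniqueness of
  derivatives allows an explicit formula \<open>f'\<close> in its place. Openness of
  \<open>A\<close> enters because a further derivative at a point sees a whole
  neighbourhood.\<close>

lemma continuously_differentiable_on_SucI:
  assumes "open A" "\<And>x. x \<in> A \<Longrightarrow> (f has_derivative f' x) (at x)"
    and "\<And>v. continuously_differentiable_on k A (\<lambda>x. f' x v)"
  shows "continuously_differentiable_on (Suc k) A f"
proof -
  have "continuously_differentiable_on k A (\<lambda>x. frechet_derivative f (at x) v)" for v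
    by (rule continuously_differentiable_on_cong[OF assms(1) _ assms(3)[of v]])
      (metis assms(2) frechet_derivative_at)
  then show ?thesis using assms(2) by (auto simp: differentiable_def)
qed

lemma continuously_differentiable_on_Suc_has_derivative:
  assumes "continuously_differentiable_on (Suc k) A f" "x \<in> A"
  shows "(f has_derivative frechet_derivative f (at x)) (at x)"
  using assms by (auto simp: frechet_derivative_works)

lemma continuously_differentiable_on_SucD:
  "continuously_differentiable_on (Suc k) A f \<Longrightarrow> continuously_differentiable_on k A f"
proof (induction k arbitrary: f)
  case 0
  then show ?case
    unfolding continuously_differentiable_on.simps
    by (blast intro: differentiable_imp_continuous_within differentiable_imp_continuous_on
        differentiable_at_imp_differentiable_on)
next
  case (Suc k)
  show ?case
    unfolding continuously_differentiable_on.simps(2)[of k]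
  proof (intro conjI ballI allI)
    show "continuously_differentiable_on k A (\<lambda>x. frechet_derivative f (at x) v)" for v
      by (rule Suc.IH) (use Suc.prems in simp)
  qed (use Suc.prems in simp)
qed

lemma continuously_differentiable_on_const:
  "continuously_differentiable_on k A (\<lambda>x. c)"
  by (induction k arbitrary: c) auto

lemma continuously_differentiable_on_linear:
  assumes "bounded_linear L" "open A"
  shows "continuously_differentiable_on k A L"
proof (cases k)
  case 0
  then show ?thesis using assms by (auto intro: linear_continuous_on)
next
  case (Suc m)
  show ?thesis unfolding Suc
    by (rule continuously_differentiable_on_SucI[OF assms(2), where f' = "\<lambda>x. L"])
      (auto intro: bounded_linear_imp_has_derivative assms continuously_differentiable_on_const)
qed

lemma continuously_differentiable_on_linear_compose:
  assumes "bounded_linear L" "open A" "continuously_differentiable_on k A f"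
  shows "continuously_differentiable_on k A (\<lambda>x. L (f x))"
  using assms(3)
proof (induction k arbitrary: f)
  case 0
  then show ?case using assms by (auto intro: bounded_linear.continuous_on)
next
  case (Suc k)
  show ?case
    by (rule continuously_differentiable_on_SucI[OF assms(2), where f' = "\<lambda>x v. L (frechet_derivative f (at x) v)"])
      (use Suc.prems in \<open>auto intro!: bounded_linear.has_derivative[OF assms(1)] Suc.IH
         simp: frechet_derivative_works[symmetric]\<close>)
qed

lemma continuously_differentiable_on_add:
  assumes "open A" "continuously_differentiable_on k A f" "continuously_differentiable_on k A g"
  shows "continuously_differentiable_on k A (\<lambda>x. f x + g x)"
  using assms(2,3)
proof (induction k arbitrary: f g)
  case 0
  then show ?case by (auto intro: continuous_on_add)
next
  case (Suc k)
  show ?case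
    by (rule continuously_differentiable_on_SucI[OF assms(1),
          where f' = "\<lambda>x v. frechet_derivative f (at x) v + frechet_derivative g (at x) v"])
      (use Suc.prems in \<open>auto intro!: has_derivative_add Suc.IH simp: frechet_derivative_works[symmetric]\<close>)
qed

lemma continuously_differentiable_on_sum:
  assumes "open A" "finite I" "\<And>i. i \<in> I \<Longrightarrow> continuously_differentiable_on k A (f i)"
  shows "continuously_differentiable_on k A (\<lambda>x. \<Sum>i\<in>I. f i x)"
  using assms(2,3)
  by (induction I)
    (auto intro!: continuously_differentiable_on_add[OF assms(1)] continuously_differentiable_on_const)

lemma continuously_differentiable_on_bilinear:
  assumes B: "bounded_bilinear B" and A: "open A"
    and f: "continuously_differentiable_on k A f" and g: "continuously_differentiable_on k A g"
  shows "continuously_differentiable_on k A (\<lambda>x. B (f x) (g x))"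
  using f g
proof (induction k arbitrary: f g)
  case 0
  then show ?case using B by (auto intro: bounded_bilinear.continuous_on)
next
  case (Suc k)
  have "continuously_differentiable_on k A f" "continuously_differentiable_on k A g"
    using Suc.prems continuously_differentiable_on_SucD by blast+
  then show ?case
    by (intro continuously_differentiable_on_SucI[OF A,
          where f' = "\<lambda>x v. B (f x) (frechet_derivative g (at x) v) + B (frechet_derivative f (at x) v) (g x)"]
        bounded_bilinear.FDERIV[OF B] continuously_differentiable_on_add[OF A] Suc.IH)
      (use Suc.prems in \<open>auto simp: frechet_derivative_works[symmetric]\<close>)
qed

text \<open>Smoothness is defined through derivatives in fixed directions, whereas the chain rule
  and \<open>tangent_fun\<close> produce derivatives in a direction that varies with the point.
  Expansion in \<open>Basis\<close> leaves fixed directions with scalar coefficients.\<close>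

lemma linear_euclidean_expansion:
  assumes "linear L"
  shows "L w = (\<Sum>b\<in>Basis. (w \<bullet> b) *\<^sub>R L b)"
proof -
  have "L w = L (\<Sum>b\<in>Basis. (w \<bullet> b) *\<^sub>R b)" by (simp add: euclidean_representation)
  also have "\<dots> = (\<Sum>b\<in>Basis. (w \<bullet> b) *\<^sub>R L b)"
    using assms by (simp add: linear_sum linear_scale)
  finally show ?thesis .
qed

lemma continuously_differentiable_on_compose:
  assumes A: "open A" and B: "open B" and AB: "f ` A \<subseteq> B"
    and f: "continuously_differentiable_on k A f" and g: "continuously_differentiable_on k B g"
  shows "continuously_differentiable_on k A (\<lambda>x. g (f x))"
  using f g
proof (induction k arbitrary: g)
  case 0
  then show ?case using AB continuous_on_compose2 by auto
next
  case (Suc k)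
  let ?h = "\<lambda>x v. \<Sum>b\<in>Basis. (frechet_derivative f (at x) v \<bullet> b) *\<^sub>R frechet_derivative g (at (f x)) b"
  have "((\<lambda>x. g (f x)) has_derivative ?h x) (at x)" if "x \<in> A" for x
  proof -
    have df: "(f has_derivative frechet_derivative f (at x)) (at x)"
      using Suc.prems(1) that continuously_differentiable_on_Suc_has_derivative by blast
    have dg: "(g has_derivative frechet_derivative g (at (f x))) (at (f x))"
      using Suc.prems(2) that AB continuously_differentiable_on_Suc_has_derivative by blast
    have "((\<lambda>x. g (f x)) has_derivative (\<lambda>v. frechet_derivative g (at (f x)) (frechet_derivative f (at x) v))) (at x)"
      using diff_chain_at[OF df dg] by (simp add: o_def)
    also have "(\<lambda>v. frechet_derivative g (at (f x)) (frechet_derivative f (at x) v)) = ?h x"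
      by (intro ext linear_euclidean_expansion has_derivative_linear[OF dg])
    finally show ?thesis .
  qed
  moreover have "continuously_differentiable_on k A (\<lambda>x. ?h x v)" for v
  proof (intro continuously_differentiable_on_sum[OF A]
      continuously_differentiable_on_bilinear[OF bounded_bilinear_scaleR A]
      continuously_differentiable_on_linear_compose[OF bounded_linear_inner_left A])
    fix b :: 'b
    show "continuously_differentiable_on k A (\<lambda>x. frechet_derivative g (at (f x)) b)"
      by (rule Suc.IH) (use Suc.prems continuously_differentiable_on_SucD in auto)
  qed (use Suc.prems in auto)
  ultimately show ?case
    by (intro continuously_differentiable_on_SucI[OF A])
qed

section \<open>Closure properties of smooth maps\<close>

lemma smooth_on_subset: "smooth_on A f \<Longrightarrow> B \<subseteq> A \<Longrightarrow> smooth_on B f"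
  unfolding smooth_on_def using continuously_differentiable_on_subset by blast

lemma smooth_on_cong:
  "open A \<Longrightarrow> (\<And>x. x \<in> A \<Longrightarrow> f x = g x) \<Longrightarrow> smooth_on A f \<Longrightarrow> smooth_on A g"
  unfolding smooth_on_def using continuously_differentiable_on_cong by blast

lemma smooth_on_linear: "bounded_linear L \<Longrightarrow> open A \<Longrightarrow> smooth_on A L"
  unfolding smooth_on_def using continuously_differentiable_on_linear by blast

lemma smooth_on_const: "smooth_on A (\<lambda>x. c)"
  unfolding smooth_on_def using continuously_differentiable_on_const by blast

lemma smooth_on_add: "open A \<Longrightarrow> smooth_on A f \<Longrightarrow> smooth_on A g \<Longrightarrow> smooth_on A (\<lambda>x. f x + g x)"
  unfolding smooth_on_def using continuously_differentiable_on_add by blast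

lemma smooth_on_sum:
  "open A \<Longrightarrow> finite I \<Longrightarrow> (\<And>i. i \<in> I \<Longrightarrow> smooth_on A (f i)) \<Longrightarrow> smooth_on A (\<lambda>x. \<Sum>i\<in>I. f i x)"
  unfolding smooth_on_def using continuously_differentiable_on_sum by blast

lemma smooth_on_bilinear:
  "bounded_bilinear B \<Longrightarrow> open A \<Longrightarrow> smooth_on A f \<Longrightarrow> smooth_on A g \<Longrightarrow> smooth_on A (\<lambda>x. B (f x) (g x))"
  unfolding smooth_on_def using continuously_differentiable_on_bilinear by blast

lemma smooth_on_compose:
  "open A \<Longrightarrow> open B \<Longrightarrow> f ` A \<subseteq> B \<Longrightarrow> smooth_on A f \<Longrightarrow> smooth_on B g \<Longrightarrow> smooth_on A (\<lambda>x. g (f x))"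
  unfolding smooth_on_def using continuously_differentiable_on_compose by blast

lemma smooth_on_linear_compose:
  "bounded_linear L \<Longrightarrow> open A \<Longrightarrow> smooth_on A f \<Longrightarrow> smooth_on A (\<lambda>x. L (f x))"
  unfolding smooth_on_def using continuously_differentiable_on_linear_compose by blast

lemma smooth_on_Pair:
  assumes "open A" "smooth_on A f" "smooth_on A g"
  shows "smooth_on A (\<lambda>x. (f x, g x))"
proof -
  have "bounded_linear (\<lambda>x. (x, 0))" "bounded_linear (\<lambda>x. (0, x))"
    by (auto intro!: bounded_linear_Pair bounded_linear_ident bounded_linear_zero)
  then have "smooth_on A (\<lambda>x. (f x, 0) + (0, g x))"
    by (intro smooth_on_add assms(1) smooth_on_linear_compose[OF _ assms(1) assms(2)]
        smooth_on_linear_compose[OF _ assms(1) assms(3)])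
  then show ?thesis by simp
qed

lemma smooth_on_differentiable: "smooth_on A f \<Longrightarrow> x \<in> A \<Longrightarrow> f differentiable at x"
  unfolding smooth_on_def by (metis continuously_differentiable_on.simps(2))

lemma smooth_on_has_derivative:
  "smooth_on A f \<Longrightarrow> x \<in> A \<Longrightarrow> (f has_derivative frechet_derivative f (at x)) (at x)"
  using smooth_on_differentiable frechet_derivative_works by blast

lemma smooth_on_derivative: "smooth_on A f \<Longrightarrow> smooth_on A (\<lambda>x. frechet_derivative f (at x) v)"
  unfolding smooth_on_def by (metis continuously_differentiable_on.simps(2))

lemma smooth_on_imp_continuous_on: "smooth_on A f \<Longrightarrow> continuous_on A f"
  unfolding smooth_on_def by (metis continuously_differentiable_on.simps(1))

text \<open>A neighbourhood that works for \<open>f\<close> works for its directional derivatives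
  with one order less, so the induction never has to shrink it.\<close>

lemma continuously_differentiable_on_local:
  assumes "\<And>x. x \<in> A \<Longrightarrow> \<exists>B. open B \<and> x \<in> B \<and> continuously_differentiable_on k B f"
  shows "continuously_differentiable_on k A f"
  using assms
proof (induction k arbitrary: f)
  case 0
  show ?case
    unfolding continuously_differentiable_on.simps(1)
  proof (rule continuous_at_imp_continuous_on, rule ballI)
    fix x assume "x \<in> A"
    from 0[OF this] obtain B where "open B" "x \<in> B" "continuous_on B f"
      unfolding continuously_differentiable_on.simps(1) by blast
    then show "isCont f x" using continuous_on_eq_continuous_at by blast
  qed
next
  case (Suc k)
  show ?case
    unfolding continuously_differentiable_on.simps(2)
  proof (intro conjI ballI allI)
    fix x assume "x \<in> A"
    from Suc.prems[OF this] show "f differentiable at x"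
      unfolding continuously_differentiable_on.simps(2) by blast
  next
    fix v
    show "continuously_differentiable_on k A (\<lambda>x. frechet_derivative f (at x) v)"
    proof (rule Suc.IH)
      fix x assume "x \<in> A"
      from Suc.prems[OF this]
      show "\<exists>B. open B \<and> x \<in> B \<and> continuously_differentiable_on k B (\<lambda>x. frechet_derivative f (at x) v)"
        unfolding continuously_differentiable_on.simps(2) by blast
    qed
  qed
qed

lemma smooth_on_local:
  assumes "\<And>x. x \<in> A \<Longrightarrow> \<exists>B. open B \<and> x \<in> B \<and> smooth_on B f"
  shows "smooth_on A f"
  unfolding smooth_on_def
proof (intro allI continuously_differentiable_on_local)
  fix k x assume "x \<in> A"
  from assms[OF this] show "\<exists>B. open B \<and> x \<in> B \<and> continuously_differentiable_on k B f"
    unfolding smooth_on_def by blast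
qed

section \<open>Symmetry of second derivatives\<close>

text \<open>Both mixed derivatives are limits of the same second difference quotient.\<close>

lemma second_difference_mvt:
  fixes f :: "'e::euclidean_space \<Rightarrow> real"
  assumes f: "smooth_on A f" and h: "h > 0"
    and seg: "\<And>s t. s \<in> {0..h} \<Longrightarrow> t \<in> {0..h} \<Longrightarrow> x + s *\<^sub>R v + t *\<^sub>R w \<in> A"
  obtains s t where "s \<in> {0..h}" "t \<in> {0..h}"
    "f (x + h *\<^sub>R v + h *\<^sub>R w) - f (x + h *\<^sub>R v) - f (x + h *\<^sub>R w) + f x =
       h * h * frechet_derivative (\<lambda>x. frechet_derivative f (at x) v) (at (x + s *\<^sub>R v + t *\<^sub>R w)) w"
proof -
  let ?D = "\<lambda>x. frechet_derivative f (at x) v"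
  have lin: "linear (frechet_derivative g (at z))" if "smooth_on A g" "z \<in> A" for g :: "'e \<Rightarrow> real" and z
    using smooth_on_has_derivative[OF that] has_derivative_linear by blast
  have curve: "((\<lambda>s. g (c + s *\<^sub>R u)) has_real_derivative frechet_derivative g (at (c + s *\<^sub>R u)) u) (at s)"
    if "smooth_on A g" "c + s *\<^sub>R u \<in> A" for g :: "'e \<Rightarrow> real" and c u s
  proof -
    have "((\<lambda>s. c + s *\<^sub>R u) has_derivative (\<lambda>t. t *\<^sub>R u)) (at s)"
      by (auto intro!: derivative_eq_intros)
    from diff_chain_at[OF this smooth_on_has_derivative[OF that]]
    have "((\<lambda>s. g (c + s *\<^sub>R u)) has_derivative
        (\<lambda>t. frechet_derivative g (at (c + s *\<^sub>R u)) (t *\<^sub>R u))) (at s)"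
      by (simp add: o_def)
    moreover have "frechet_derivative g (at (c + s *\<^sub>R u)) (t *\<^sub>R u) =
        frechet_derivative g (at (c + s *\<^sub>R u)) u * t" for t
      using linear_scale[OF lin[OF that]] by simp
    ultimately show ?thesis by (simp add: has_field_derivative_def)
  qed
  \<comment> \<open>\<open>p h - p 0\<close> is the second difference. One mean value step in
    direction \<open>v\<close> leaves an increment of \<open>?D\<close> in direction
    \<open>w\<close>, which is \<open>q h - q 0\<close> below; a second step produces the mixed
    derivative.\<close>
  define p where "p s = f ((x + h *\<^sub>R w) + s *\<^sub>R v) - f (x + s *\<^sub>R v)" for s
  have dp: "(p has_real_derivative ?D ((x + h *\<^sub>R w) + s *\<^sub>R v) - ?D (x + s *\<^sub>R v)) (at s)"
    if "s \<in> {0..h}" for s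
    unfolding p_def
    using seg[OF that, of h] seg[OF that, of 0] h
    by (intro DERIV_diff curve[OF f]) (simp_all add: ac_simps)
  have "\<exists>s>0. s < h \<and> p h - p 0 = (h - 0) * (?D ((x + h *\<^sub>R w) + s *\<^sub>R v) - ?D (x + s *\<^sub>R v))"
    by (rule MVT2[OF h dp]) simp
  then obtain s where s: "s > 0" "s < h"
    "p h - p 0 = h * (?D ((x + h *\<^sub>R w) + s *\<^sub>R v) - ?D (x + s *\<^sub>R v))"
    by auto
  define q where "q t = ?D ((x + s *\<^sub>R v) + t *\<^sub>R w)" for t
  have dq: "(q has_real_derivative frechet_derivative ?D (at ((x + s *\<^sub>R v) + t *\<^sub>R w)) w) (at t)"
    if "t \<in> {0..h}" for t
    unfolding q_def using seg[OF _ that, of s] s by (intro curve smooth_on_derivative f) auto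
  have "\<exists>t>0. t < h \<and> q h - q 0 = (h - 0) * frechet_derivative ?D (at ((x + s *\<^sub>R v) + t *\<^sub>R w)) w"
    by (rule MVT2[OF h dq]) simp
  then obtain t where t: "t > 0" "t < h"
    "q h - q 0 = h * frechet_derivative ?D (at ((x + s *\<^sub>R v) + t *\<^sub>R w)) w"
    by auto
  have "(x + h *\<^sub>R w) + s *\<^sub>R v = (x + s *\<^sub>R v) + h *\<^sub>R w" by simp
  with s(3) have "p h - p 0 = h * (q h - q 0)" unfolding q_def by simp
  then have "p h - p 0 = h * h * frechet_derivative ?D (at (x + s *\<^sub>R v + t *\<^sub>R w)) w"
    using t(3) by simp
  moreover have comm: "x + h *\<^sub>R w + h *\<^sub>R v = x + h *\<^sub>R v + h *\<^sub>R w" by simp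
  have "p h - p 0 = f (x + h *\<^sub>R v + h *\<^sub>R w) - f (x + h *\<^sub>R v) - f (x + h *\<^sub>R w) + f x"
    unfolding p_def comm by simp
  ultimately show thesis using that[of s t] s(1,2) t(1,2) by simp
qed

lemma real_second_derivative_symmetric:
  fixes f :: "'e::euclidean_space \<Rightarrow> real"
  assumes f: "smooth_on A f" and A: "open A" "x \<in> A"
  shows "frechet_derivative (\<lambda>x. frechet_derivative f (at x) v) (at x) w =
         frechet_derivative (\<lambda>x. frechet_derivative f (at x) w) (at x) v"
proof (rule ccontr)
  let ?P = "\<lambda>x. frechet_derivative (\<lambda>x. frechet_derivative f (at x) v) (at x) w"
  let ?Q = "\<lambda>x. frechet_derivative (\<lambda>x. frechet_derivative f (at x) w) (at x) v"
  assume "?P x \<noteq> ?Q x"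
  \<comment> \<open>Half of the gap: values within \<open>e\<close> of both limits would make the
    gap smaller than \<open>2 * e\<close>, hence smaller than itself.\<close>
  define e where "e = \<bar>?P x - ?Q x\<bar> / 2"
  have e: "e > 0" using \<open>?P x \<noteq> ?Q x\<close> by (simp add: e_def)
  have "isCont (\<lambda>x. frechet_derivative (\<lambda>x. frechet_derivative f (at x) u) (at x) u') x" for u u'
    using smooth_on_imp_continuous_on[OF smooth_on_derivative[OF smooth_on_derivative[OF f]]]
      continuous_on_eq_continuous_at[OF A(1)] A(2) by blast
  then have "isCont ?P x" "isCont ?Q x" by blast+
  then obtain d1 d2 where d1: "d1 > 0" "\<And>z. dist z x < d1 \<Longrightarrow> dist (?P z) (?P x) < e"
    and d2: "d2 > 0" "\<And>z. dist z x < d2 \<Longrightarrow> dist (?Q z) (?Q x) < e"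
    using e unfolding continuous_at_eps_delta by metis
  obtain d3 where d3: "d3 > 0" "ball x d3 \<subseteq> A" using A open_contains_ball by blast
  define d where "d = min d1 (min d2 d3)"
  have d: "d > 0" using d1 d2 d3 by (simp add: d_def)
  \<comment> \<open>Keeps the parallelogram with sides \<open>h *\<^sub>R v\<close> and
    \<open>h *\<^sub>R w\<close> inside the ball of radius \<open>d\<close>. The summand 1 avoids a
    zero denominator and makes the estimate strict.\<close>
  define h where "h = d / (norm v + norm w + 1)"
  have nn: "norm v + norm w + 1 > 0" by (simp add: add_nonneg_pos)
  have h: "h > 0" using d nn by (simp add: h_def)
  have near: "dist (x + s *\<^sub>R v + t *\<^sub>R w) x < d" if "s \<in> {0..h}" "t \<in> {0..h}" for s t
  proof -
    have "dist (x + s *\<^sub>R v + t *\<^sub>R w) x \<le> norm (s *\<^sub>R v) + norm (t *\<^sub>R w)"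
      using norm_triangle_ineq[of "s *\<^sub>R v" "t *\<^sub>R w"] by (simp add: dist_norm add.assoc)
    also have "\<dots> \<le> h * norm v + h * norm w"
      using that by (intro add_mono) (auto intro: mult_right_mono)
    also have "\<dots> < h * (norm v + norm w + 1)" using h by (simp add: algebra_simps)
    also have "\<dots> = d" using nn by (simp add: h_def)
    finally show ?thesis .
  qed
  have sA: "x + s *\<^sub>R v + t *\<^sub>R w \<in> A" if "s \<in> {0..h}" "t \<in> {0..h}" for s t
    using near[OF that] d3 by (auto simp: d_def dist_commute)
  obtain s t where st: "s \<in> {0..h}" "t \<in> {0..h}"
    "f (x + h *\<^sub>R v + h *\<^sub>R w) - f (x + h *\<^sub>R v) - f (x + h *\<^sub>R w) + f x =
       h * h * ?P (x + s *\<^sub>R v + t *\<^sub>R w)"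
    using second_difference_mvt[OF f h sA] by blast
  \<comment> \<open>The second difference does not change when \<open>v\<close> and \<open>w\<close>
    are exchanged, so the mean value lemma applied in the other order reaches \<open>?Q\<close> from
    the same number.\<close>
  have sA': "x + s *\<^sub>R w + t *\<^sub>R v \<in> A" if "s \<in> {0..h}" "t \<in> {0..h}" for s t
    using sA[OF that(2,1)] by (simp add: algebra_simps)
  obtain s' t' where st': "s' \<in> {0..h}" "t' \<in> {0..h}"
    "f (x + h *\<^sub>R w + h *\<^sub>R v) - f (x + h *\<^sub>R w) - f (x + h *\<^sub>R v) + f x =
       h * h * ?Q (x + s' *\<^sub>R w + t' *\<^sub>R v)"
    using second_difference_mvt[OF f h sA'] by blast
  have "h * h * ?P (x + s *\<^sub>R v + t *\<^sub>R w) = h * h * ?Q (x + s' *\<^sub>R w + t' *\<^sub>R v)"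
    using st(3) st'(3) by (simp add: algebra_simps)
  then have eq: "?P (x + s *\<^sub>R v + t *\<^sub>R w) = ?Q (x + t' *\<^sub>R v + s' *\<^sub>R w)"
    using h by (simp add: algebra_simps)
  have "dist (?P (x + s *\<^sub>R v + t *\<^sub>R w)) (?P x) < e"
    using near[OF st(1,2)] by (intro d1) (simp add: d_def)
  moreover have "dist (?Q (x + t' *\<^sub>R v + s' *\<^sub>R w)) (?Q x) < e"
    using near[OF st'(2,1)] by (intro d2) (simp add: d_def)
  ultimately have "\<bar>?P x - ?Q x\<bar> < 2 * e" using eq by (simp add: dist_real_def)
  then show False by (simp add: e_def)
qed

lemma second_derivative_symmetric:
  fixes f :: "'e::euclidean_space \<Rightarrow> 'f::euclidean_space"
  assumes f: "smooth_on A f" and A: "open A" "x \<in> A"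
  shows "frechet_derivative (\<lambda>x. frechet_derivative f (at x) v) (at x) w =
         frechet_derivative (\<lambda>x. frechet_derivative f (at x) w) (at x) v"
proof (rule euclidean_eqI)
  fix b :: 'f
  have inner: "frechet_derivative (\<lambda>x. g x \<bullet> b) (at z) u = frechet_derivative g (at z) u \<bullet> b"
    if "smooth_on A g" "z \<in> A" for g :: "'e \<Rightarrow> 'f" and z u
    using frechet_derivative_at[OF bounded_linear.has_derivative[OF bounded_linear_inner_left
          smooth_on_has_derivative[OF that]], of b]
    by metis
  \<comment> \<open>The inner product is pulled out of the first derivative on all of
    \<open>A\<close>, because the second derivative at \<open>x\<close> depends on a
    neighbourhood.\<close>
  have *: "frechet_derivative (\<lambda>x. frechet_derivative (\<lambda>x. f x \<bullet> b) (at x) v) (at x) w =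
      frechet_derivative (\<lambda>x. frechet_derivative f (at x) v) (at x) w \<bullet> b" for v w
  proof -
    have "frechet_derivative (\<lambda>x. frechet_derivative f (at x) v \<bullet> b) (at x) =
        frechet_derivative (\<lambda>x. frechet_derivative (\<lambda>x. f x \<bullet> b) (at x) v) (at x)"
      by (rule frechet_derivative_transform_within_open[OF _ A])
        (auto simp: inner[OF f] intro!: smooth_on_differentiable[OF smooth_on_linear_compose[OF
            bounded_linear_inner_left A(1) smooth_on_derivative[OF f]] A(2)])
    then show ?thesis using inner[OF smooth_on_derivative[OF f] A(2), of v w] by metis
  qed
  have "smooth_on A (\<lambda>x. f x \<bullet> b)"
    by (rule smooth_on_linear_compose[OF bounded_linear_inner_left A(1) f])
  from real_second_derivative_symmetric[OF this A, of v w]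
  show "frechet_derivative (\<lambda>x. frechet_derivative f (at x) v) (at x) w \<bullet> b =
        frechet_derivative (\<lambda>x. frechet_derivative f (at x) w) (at x) v \<bullet> b"
    by (simp add: *)
qed

section \<open>Tangent maps between open subsets of Euclidean spaces\<close>

text \<open>Bundling value and derivative turns the chain rule into functoriality, and lets chart
  changes of the second tangent bundle be written as
  \<open>tangent_fun (tangent_fun f)\<close>.\<close>

definition tangent_fun ::
  "('e::euclidean_space \<Rightarrow> 'f::euclidean_space) \<Rightarrow> 'e \<times> 'e \<Rightarrow> 'f \<times> 'f" where
  "tangent_fun f = (\<lambda>(x, v). (f x, frechet_derivative f (at x) v))"

lemma tangent_fun_Pair: "tangent_fun f (x, v) = (f x, frechet_derivative f (at x) v)"
  by (simp add: tangent_fun_def)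

lemma fst_tangent_fun [simp]: "fst (tangent_fun f z) = f (fst z)"
  by (simp add: tangent_fun_def split_beta)

lemma tangent_fun_cong:
  assumes "open A" "fst z \<in> A" "f differentiable at (fst z)" "\<And>x. x \<in> A \<Longrightarrow> f x = g x"
  shows "tangent_fun f z = tangent_fun g z"
  using frechet_derivative_transform_within_open[OF assms(3,1,2,4)] assms(2,4)
  by (simp add: tangent_fun_def split_beta)

lemma tangent_fun_compose:
  assumes "f differentiable at (fst z)" "g differentiable at (f (fst z))"
  shows "tangent_fun (g \<circ> f) z = tangent_fun g (tangent_fun f z)"
  using frechet_derivative_compose[OF assms] by (simp add: tangent_fun_def split_beta)

lemma tangent_fun_id [simp]: "tangent_fun id z = z" "tangent_fun (\<lambda>x. x) z = z"
  by (simp_all add: tangent_fun_def split_beta)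

lemma tangent_fun_linear: "bounded_linear L \<Longrightarrow> tangent_fun L z = (L (fst z), L (snd z))"
  using frechet_derivative_at[OF bounded_linear_imp_has_derivative[of L "at (fst z)"]]
  by (simp add: tangent_fun_def split_beta)

lemma smooth_on_tangent_fun:
  assumes "open A" "smooth_on A f"
  shows "smooth_on (A \<times> UNIV) (tangent_fun f)"
proof -
  have o: "open (A \<times> (UNIV :: 'a set))" using assms(1) by (simp add: open_Times)
  have fst: "smooth_on (A \<times> UNIV) (fst :: 'a \<times> 'a \<Rightarrow> 'a)"
    by (rule smooth_on_linear[OF bounded_linear_fst o])
  have *: "smooth_on (A \<times> (UNIV :: 'a set)) (\<lambda>z. g (fst z))"
    if "smooth_on A g" for g :: "'a \<Rightarrow> 'b"
    by (rule smooth_on_compose[OF o assms(1) _ fst that]) auto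
  have snd: "smooth_on (A \<times> UNIV) (\<lambda>z :: 'a \<times> 'a. snd z \<bullet> b)" for b :: 'a
    by (rule smooth_on_linear[OF _ o])
      (rule bounded_linear_compose[OF bounded_linear_inner_left bounded_linear_snd])
  have "smooth_on (A \<times> UNIV) (\<lambda>z. (f (fst z), \<Sum>b\<in>Basis. (snd z \<bullet> b) *\<^sub>R frechet_derivative f (at (fst z)) b))"
    by (intro smooth_on_Pair o * assms smooth_on_sum smooth_on_derivative snd
        smooth_on_bilinear[OF bounded_bilinear_scaleR o]) auto
  then show ?thesis
  proof (rule smooth_on_cong[OF o, rotated])
    fix z :: "'a \<times> 'a" assume "z \<in> A \<times> UNIV"
    then have "fst z \<in> A" by auto
    then have "linear (frechet_derivative f (at (fst z)))"
      using smooth_on_has_derivative[OF assms(2)] has_derivative_linear by blast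
    from linear_euclidean_expansion[OF this, of "snd z"]
    show "(f (fst z), \<Sum>b\<in>Basis. (snd z \<bullet> b) *\<^sub>R frechet_derivative f (at (fst z)) b) = tangent_fun f z"
      by (simp add: tangent_fun_def split_beta)
  qed
qed

text \<open>The total derivative exists because \<open>tangent_fun f\<close> is smooth. By linearity
  it is determined by the two slices with \<open>y\<close> fixed and with \<open>x\<close> fixed,
  and each slice is differentiated separately.\<close>

lemma frechet_derivative_tangent_fun:
  assumes A: "open A" "smooth_on A f" "x \<in> A"
  shows "frechet_derivative (tangent_fun f) (at (x, y)) (X, Y) =
    (frechet_derivative f (at x) X,
     frechet_derivative (\<lambda>x. frechet_derivative f (at x) y) (at x) X + frechet_derivative f (at x) Y)"
proof -
  let ?D = "frechet_derivative (tangent_fun f) (at (x, y))"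
  have "(x, y) \<in> A \<times> UNIV" using A by simp
  from smooth_on_has_derivative[OF smooth_on_tangent_fun[OF A(1,2)] this]
  have D: "(tangent_fun f has_derivative ?D) (at (x, y))" .
  have "((\<lambda>x. (x, y)) has_derivative (\<lambda>h. (h, 0))) (at x)"
    by (auto intro!: derivative_eq_intros)
  from diff_chain_at[OF this D]
  have 1: "((\<lambda>x. (f x, frechet_derivative f (at x) y)) has_derivative (\<lambda>h. ?D (h, 0))) (at x)"
    by (simp add: o_def tangent_fun_Pair)
  have "((\<lambda>x. (f x, frechet_derivative f (at x) y)) has_derivative
      (\<lambda>h. (frechet_derivative f (at x) h, frechet_derivative (\<lambda>x. frechet_derivative f (at x) y) (at x) h))) (at x)"
    by (intro has_derivative_Pair smooth_on_has_derivative[OF _ A(3)] smooth_on_derivative A(2))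
  from has_derivative_unique[OF 1 this]
  have e1: "?D (X, 0) = (frechet_derivative f (at x) X, frechet_derivative (\<lambda>x. frechet_derivative f (at x) y) (at x) X)"
    by metis
  have "((\<lambda>y. (x, y)) has_derivative (\<lambda>h. (0, h))) (at y)"
    by (auto intro!: derivative_eq_intros)
  from diff_chain_at[OF this D]
  have 2: "((\<lambda>y. (f x, frechet_derivative f (at x) y)) has_derivative (\<lambda>h. ?D (0, h))) (at y)"
    by (simp add: o_def tangent_fun_Pair)
  have "bounded_linear (frechet_derivative f (at x))"
    using smooth_on_has_derivative[OF A(2,3)] has_derivative_bounded_linear by blast
  then have "((\<lambda>y. (f x, frechet_derivative f (at x) y)) has_derivative
      (\<lambda>h. (0, frechet_derivative f (at x) h))) (at y)"
    by (intro has_derivative_Pair has_derivative_const bounded_linear_imp_has_derivative)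
  from has_derivative_unique[OF 2 this]
  have e2: "?D (0, Y) = (0, frechet_derivative f (at x) Y)" by metis
  have "?D (X, Y) = ?D (X, 0) + ?D (0, Y)"
    using linear_add[OF has_derivative_linear[OF D], of "(X, 0)" "(0, Y)"] by simp
  then show ?thesis using e1 e2 by simp
qed

section \<open>The flip and double tangent maps\<close>

definition flip :: "('a \<times> 'b) \<times> ('c \<times> 'd) \<Rightarrow> ('a \<times> 'c) \<times> ('b \<times> 'd)" where
  "flip = (\<lambda>((x, y), (X, Y)). ((x, X), (y, Y)))"

lemma flip_Pair [simp]: "flip ((x, y), (X, Y)) = ((x, X), (y, Y))"
  by (simp add: flip_def)

lemma flip_flip [simp]: "flip (flip z) = z"
  by (simp add: flip_def split_beta)

text \<open>With foot point \<open>a\<close> and components \<open>b\<close>, this is the semispray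
  condition in coordinates.\<close>

lemma flip_Pair_eq: "fst b = snd a \<Longrightarrow> flip (a, b) = (a, b)"
  by (cases a; cases b) simp

lemma bounded_linear_flip:
  "bounded_linear (flip :: ('a \<times> 'b) \<times> ('c \<times> 'd) \<Rightarrow>
    ('a::real_normed_vector \<times> 'c::real_normed_vector) \<times> ('b::real_normed_vector \<times> 'd::real_normed_vector))"
proof -
  have eq: "(flip :: ('a \<times> 'b) \<times> ('c \<times> 'd) \<Rightarrow> _) =
      (\<lambda>z. ((fst (fst z), fst (snd z)), (snd (fst z), snd (snd z))))"
    by (auto simp: flip_def)
  show ?thesis
    by (subst eq) (intro bounded_linear_Pair bounded_linear_compose[OF bounded_linear_fst]
        bounded_linear_compose[OF bounded_linear_snd] bounded_linear_fst bounded_linear_snd)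
qed

lemma tangent_fun_flip: "tangent_fun flip z = (flip (fst z), flip (snd z))"
  by (rule tangent_fun_linear[OF bounded_linear_flip])

text \<open>The double tangent map has the entries \<open>f x\<close>, \<open>D f y\<close>,
  \<open>D f X\<close> and \<open>D^2 f (y, X) + D f Y\<close>. Exchanging \<open>y\<close> and
  \<open>X\<close> swaps the middle two, and the last is unchanged by symmetry of
  \<open>D^2 f\<close>.\<close>

lemma flip_tangent_fun_tangent_fun:
  assumes "open A" "smooth_on A f" "fst (fst z) \<in> A"
  shows "flip (tangent_fun (tangent_fun f) z) = tangent_fun (tangent_fun f) (flip z)"
proof -
  obtain x y X Y where z: "z = ((x, y), (X, Y))" by (metis prod.collapse)
  with assms show ?thesis
    by (simp add: tangent_fun_Pair frechet_derivative_tangent_fun[OF assms(1,2)]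
        second_derivative_symmetric[OF assms(2,1), of x X y])
qed

section \<open>Charts of manifolds and of their tangent bundles\<close>

text \<open>The conditions of \<^const>\<open>smooth_manifold\<close> that do not involve the topology.\<close>

definition smooth_atlas :: "('a, 'e::euclidean_space) manifold \<Rightarrow> bool" where
  "smooth_atlas M \<longleftrightarrow>
     (\<forall>c\<in>atlas M. inj_on (coord c) (chart_dom c) \<and> open (coord c ` chart_dom c)) \<and>
     (\<forall>c\<in>atlas M. \<forall>d\<in>atlas M.
        open (coord c ` (chart_dom c \<inter> chart_dom d)) \<and>
        smooth_on (coord c ` (chart_dom c \<inter> chart_dom d)) (coord d \<circ> coord_inv c)) \<and>
     (\<forall>p\<in>points M. chart_at M p \<in> atlas M \<and> p \<in> chart_dom (chart_at M p))"

lemma smooth_manifold_imp_smooth_atlas: "smooth_manifold M \<Longrightarrow> smooth_atlas M"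
  by (simp add: smooth_manifold_def smooth_atlas_def)

context
  fixes M :: "('a, 'e::euclidean_space) manifold"
  assumes M: "smooth_atlas M"
begin

lemma inj_on_coord: "c \<in> atlas M \<Longrightarrow> inj_on (coord c) (chart_dom c)"
  using M by (simp add: smooth_atlas_def)

lemma open_coord_dom: "c \<in> atlas M \<Longrightarrow> open (coord c ` chart_dom c)"
  using M by (simp add: smooth_atlas_def)

lemma coord_inv_coord:
  "c \<in> atlas M \<Longrightarrow> p \<in> chart_dom c \<Longrightarrow> coord_inv c (coord c p) = p"
  unfolding coord_inv_def by (rule the_inv_into_f_f[OF inj_on_coord])

lemma open_coord_Int:
  "c \<in> atlas M \<Longrightarrow> d \<in> atlas M \<Longrightarrow> open (coord c ` (chart_dom c \<inter> chart_dom d))"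
  using M by (simp add: smooth_atlas_def)

lemma smooth_on_transition:
  "c \<in> atlas M \<Longrightarrow> d \<in> atlas M \<Longrightarrow>
   smooth_on (coord c ` (chart_dom c \<inter> chart_dom d)) (coord d \<circ> coord_inv c)"
  using M by (simp add: smooth_atlas_def)

lemma chart_at_atlas: "p \<in> points M \<Longrightarrow> chart_at M p \<in> atlas M"
  using M by (simp add: smooth_atlas_def)

lemma in_chart_at: "p \<in> points M \<Longrightarrow> p \<in> chart_dom (chart_at M p)"
  using M by (simp add: smooth_atlas_def)

lemma chart_dom_points: "c \<in> atlas M \<Longrightarrow> p \<in> chart_dom c \<Longrightarrow> p \<in> points M"
  by (auto simp: points_def)

lemmas smooth_atlas_simps = coord_inv_coord chart_at_atlas in_chart_at

lemma transition_differentiable: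
  "c \<in> atlas M \<Longrightarrow> d \<in> atlas M \<Longrightarrow> p \<in> chart_dom c \<Longrightarrow> p \<in> chart_dom d \<Longrightarrow>
   (coord d \<circ> coord_inv c) differentiable at (coord c p)"
  by (rule smooth_on_differentiable[OF smooth_on_transition]) auto

text \<open>Cocycle rule for tangent vectors. Since \<open>coord_inv\<close> is meaningful only on
  the image of its chart, the direct and the composed transition are compared on the triple overlap
  \<open>?A\<close>, which is open and therefore determines the derivatives.\<close>

lemma tangent_transition_compose:
  assumes "b \<in> atlas M" "c \<in> atlas M" "d \<in> atlas M"
    and "p \<in> chart_dom b" "p \<in> chart_dom c" "p \<in> chart_dom d" and z: "fst z = coord b p"
  shows "tangent_fun (coord d \<circ> coord_inv c) (tangent_fun (coord c \<circ> coord_inv b) z) =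
    tangent_fun (coord d \<circ> coord_inv b) z"
proof -
  let ?A = "coord b ` (chart_dom b \<inter> chart_dom c) \<inter> coord b ` (chart_dom b \<inter> chart_dom d)"
  have "tangent_fun (coord d \<circ> coord_inv b) z =
      tangent_fun ((coord d \<circ> coord_inv c) \<circ> (coord c \<circ> coord_inv b)) z"
  proof (rule tangent_fun_cong[where A = ?A])
    show "open ?A" using assms by (intro open_Int open_coord_Int)
    show "fst z \<in> ?A" using assms by auto
    show "(coord d \<circ> coord_inv b) differentiable at (fst z)"
      using assms by (simp add: smooth_atlas_simps transition_differentiable)
    fix x assume "x \<in> ?A"
    then obtain q where "x = coord b q" "q \<in> chart_dom b" "q \<in> chart_dom c" by auto
    then show "(coord d \<circ> coord_inv b) x = ((coord d \<circ> coord_inv c) \<circ> (coord c \<circ> coord_inv b)) x"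
      using assms by (simp add: smooth_atlas_simps)
  qed
  also have "\<dots> = tangent_fun (coord d \<circ> coord_inv c) (tangent_fun (coord c \<circ> coord_inv b) z)"
    using assms by (intro tangent_fun_compose) (simp_all add: smooth_atlas_simps transition_differentiable)
  finally show ?thesis by simp
qed

lemma tangent_transition_self:
  assumes "c \<in> atlas M" "p \<in> chart_dom c" and z: "fst z = coord c p"
  shows "tangent_fun (coord c \<circ> coord_inv c) z = z"
proof -
  have "tangent_fun (coord c \<circ> coord_inv c) z = tangent_fun id z"
    by (rule tangent_fun_cong[OF open_coord_dom[OF assms(1)]])
      (use assms in \<open>auto simp: smooth_atlas_simps transition_differentiable\<close>)
  then show ?thesis by simp
qed

end

section \<open>Induced charts on the tangent bundle\<close>

lemma chart_dom_tangent_chart [simp]: "chart_dom (tangent_chart M c) = chart_dom c \<times> UNIV"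
  by (simp add: tangent_chart_def)

lemma coord_tangent_chart:
  "coord (tangent_chart M c) (p, v) =
    (coord c p, snd (tangent_fun (coord c \<circ> coord_inv (chart_at M p)) (coord (chart_at M p) p, v)))"
  by (simp add: tangent_chart_def tangent_fun_Pair)

lemma fst_coord_tangent_chart [simp]: "fst (coord (tangent_chart M c) \<xi>) = coord c (fst \<xi>)"
  by (cases \<xi>) (simp add: coord_tangent_chart)

lemma atlas_tangent_bundle [simp]: "atlas (tangent_bundle M) = tangent_chart M ` atlas M"
  by (simp add: tangent_bundle_def)

lemma chart_at_tangent_bundle [simp]:
  "chart_at (tangent_bundle M) (p, v) = tangent_chart M (chart_at M p)"
  by (simp add: tangent_bundle_def)

lemma points_tangent_bundle [simp]: "points (tangent_bundle M) = points M \<times> UNIV"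
  by (auto simp: points_def)

context
  fixes M :: "('a, 'e::euclidean_space) manifold"
  assumes M: "smooth_atlas M"
begin

lemma coord_tangent_chart_tangent_fun:
  assumes "c \<in> atlas M" "p \<in> chart_dom c"
  shows "coord (tangent_chart M c) (p, v) =
    tangent_fun (coord c \<circ> coord_inv (chart_at M p)) (coord (chart_at M p) p, v)"
  using chart_dom_points[OF M assms] by (simp add: prod_eq_iff smooth_atlas_simps[OF M] coord_tangent_chart)

lemma coord_tangent_chart_change:
  assumes "c \<in> atlas M" "d \<in> atlas M" "fst \<xi> \<in> chart_dom c" "fst \<xi> \<in> chart_dom d"
  shows "coord (tangent_chart M d) \<xi> = tangent_fun (coord d \<circ> coord_inv c) (coord (tangent_chart M c) \<xi>)"
proof -
  obtain p v where \<xi>: "\<xi> = (p, v)" by (cases \<xi>)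
  show ?thesis
    using assms chart_dom_points[OF M assms(1,3)]
    by (simp add: \<xi> coord_tangent_chart_tangent_fun
        tangent_transition_compose[OF M, of "chart_at M p" c d p] smooth_atlas_simps[OF M])
qed

lemma coord_tangent_chart_at:
  "p \<in> points M \<Longrightarrow> coord (tangent_chart M (chart_at M p)) (p, v) = (coord (chart_at M p) p, v)"
  by (simp add: coord_tangent_chart_tangent_fun smooth_atlas_simps[OF M] tangent_transition_self[OF M, of _ p])

text \<open>Equal coordinates force a common foot point. After a change to the preferred chart
  there, the fibre coordinate is the encoded vector itself.\<close>

lemma inj_on_coord_tangent_chart:
  assumes "c \<in> atlas M"
  shows "inj_on (coord (tangent_chart M c)) (chart_dom c \<times> UNIV)"
proof (rule inj_onI)
  fix \<xi> \<eta> :: "'a \<times> 'e"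
  assume dom: "\<xi> \<in> chart_dom c \<times> UNIV" "\<eta> \<in> chart_dom c \<times> UNIV"
    and eq: "coord (tangent_chart M c) \<xi> = coord (tangent_chart M c) \<eta>"
  obtain p v q w where \<xi>: "\<xi> = (p, v)" "\<eta> = (q, w)" by (cases \<xi>, cases \<eta>)
  have p: "p \<in> chart_dom c" "q \<in> chart_dom c" using dom \<xi> by auto
  have "coord c p = coord c q" using arg_cong[OF eq, of fst] by (simp add: \<xi>)
  then have pq: "p = q" using inj_on_coord[OF M assms] p by (auto dest: inj_onD)
  have pp: "p \<in> points M" using chart_dom_points[OF M assms] p by blast
  have "coord (tangent_chart M (chart_at M p)) \<xi> = coord (tangent_chart M (chart_at M p)) \<eta>"
    using coord_tangent_chart_change[OF assms, of "chart_at M p"] eq p pp by (simp add: smooth_atlas_simps[OF M] \<xi> pq)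
  then show "\<xi> = \<eta>" using pp by (simp add: \<xi> pq coord_tangent_chart_at)
qed

lemma coord_tangent_chart_surj:
  assumes "c \<in> atlas M" "p \<in> chart_dom c"
  obtains v where "coord (tangent_chart M c) (p, v) = (coord c p, y)"
proof
  let ?e = "chart_at M p"
  have e: "?e \<in> atlas M" "p \<in> chart_dom ?e" using chart_dom_points[OF M assms] by (simp_all add: smooth_atlas_simps[OF M])
  let ?v = "snd (tangent_fun (coord ?e \<circ> coord_inv c) (coord c p, y))"
  have "(coord ?e p, ?v) = tangent_fun (coord ?e \<circ> coord_inv c) (coord c p, y)"
    using assms by (simp add: prod_eq_iff smooth_atlas_simps[OF M])
  then show "coord (tangent_chart M c) (p, ?v) = (coord c p, y)"
    using assms e
    by (simp add: coord_tangent_chart_tangent_fun smooth_atlas_simps[OF M] tangent_transition_compose[OF M, of c ?e c p]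
        tangent_transition_self[OF M, of c p])
qed

lemma image_coord_tangent_chart:
  assumes "c \<in> atlas M" "V \<subseteq> chart_dom c"
  shows "coord (tangent_chart M c) ` (V \<times> UNIV) = coord c ` V \<times> UNIV"
proof (intro equalityI subsetI)
  fix z assume "z \<in> coord (tangent_chart M c) ` (V \<times> UNIV)"
  then show "z \<in> coord c ` V \<times> UNIV" by (auto simp: coord_tangent_chart)
next
  fix z :: "'e \<times> 'e" assume "z \<in> coord c ` V \<times> UNIV"
  then obtain p y where z: "z = (coord c p, y)" "p \<in> V" by auto
  then obtain v where "coord (tangent_chart M c) (p, v) = z"
    using coord_tangent_chart_surj[OF assms(1), of p y] assms(2) by auto
  then show "z \<in> coord (tangent_chart M c) ` (V \<times> UNIV)" using z by (metis imageI SigmaI UNIV_I)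
qed

text \<open>Chart changes of the tangent bundle are tangent maps of chart changes of
  \<open>M\<close>, hence smooth. This is what permits iteration of the construction.\<close>

lemma smooth_atlas_tangent_bundle: "smooth_atlas (tangent_bundle M)"
  unfolding smooth_atlas_def
proof (intro conjI ballI)
  fix c assume "c \<in> atlas (tangent_bundle M)"
  then obtain c' where c: "c' \<in> atlas M" "c = tangent_chart M c'" by auto
  show inj: "inj_on (coord c) (chart_dom c)" using inj_on_coord_tangent_chart c by simp
  show "open (coord c ` chart_dom c)"
    using c by (simp add: image_coord_tangent_chart open_Times open_coord_dom[OF M])
  fix d assume "d \<in> atlas (tangent_bundle M)"
  then obtain d' where d: "d' \<in> atlas M" "d = tangent_chart M d'" by auto
  let ?V = "chart_dom c' \<inter> chart_dom d'"
  have im: "coord c ` (chart_dom c \<inter> chart_dom d) = coord c' ` ?V \<times> UNIV"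
    using c d image_coord_tangent_chart[OF c(1), of ?V] by (simp add: Times_Int_Times)
  show op: "open (coord c ` (chart_dom c \<inter> chart_dom d))"
    unfolding im using c d by (simp add: open_Times open_coord_Int[OF M])
  show "smooth_on (coord c ` (chart_dom c \<inter> chart_dom d)) (coord d \<circ> coord_inv c)"
  proof (rule smooth_on_cong[OF op])
    show "smooth_on (coord c ` (chart_dom c \<inter> chart_dom d)) (tangent_fun (coord d' \<circ> coord_inv c'))"
      unfolding im by (intro smooth_on_tangent_fun smooth_on_transition[OF M] open_coord_Int[OF M] c d)
    fix z assume "z \<in> coord c ` (chart_dom c \<inter> chart_dom d)"
    then obtain \<xi> where \<xi>: "z = coord c \<xi>" "\<xi> \<in> chart_dom c" "\<xi> \<in> chart_dom d" by auto
    have "coord_inv c z = \<xi>" unfolding coord_inv_def \<xi>(1) by (rule the_inv_into_f_f[OF inj \<xi>(2)])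
    then show "tangent_fun (coord d' \<circ> coord_inv c') z = (coord d \<circ> coord_inv c) z"
      using coord_tangent_chart_change[OF c(1) d(1), of \<xi>] \<xi> c d by auto
  qed
next
  fix \<xi> assume "\<xi> \<in> points (tangent_bundle M)"
  then show "chart_at (tangent_bundle M) \<xi> \<in> atlas (tangent_bundle M)"
    and "\<xi> \<in> chart_dom (chart_at (tangent_bundle M) \<xi>)"
    by (cases \<xi>; simp add: smooth_atlas_simps[OF M])+
qed

end

section \<open>Smooth maps between manifolds\<close>

abbreviation chart_rep :: "('a, 'e) chart \<Rightarrow> ('b, 'f) chart \<Rightarrow> ('a \<Rightarrow> 'b) \<Rightarrow> 'e \<Rightarrow> 'f" where
  "chart_rep c d f \<equiv> coord d \<circ> f \<circ> coord_inv c"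

abbreviation chart_rep_dom :: "('a, 'e) chart \<Rightarrow> ('b, 'f) chart \<Rightarrow> 'a set \<Rightarrow> ('a \<Rightarrow> 'b) \<Rightarrow> 'e set" where
  "chart_rep_dom c d U f \<equiv> coord c ` {p \<in> U \<inter> chart_dom c. f p \<in> chart_dom d}"

lemma smooth_mapD:
  assumes "smooth_map M U N f"
  shows "U \<subseteq> points M" "f ` U \<subseteq> points N"
    and "c \<in> atlas M \<Longrightarrow> d \<in> atlas N \<Longrightarrow> open (chart_rep_dom c d U f)"
    and "c \<in> atlas M \<Longrightarrow> d \<in> atlas N \<Longrightarrow> smooth_on (chart_rep_dom c d U f) (chart_rep c d f)"
  using assms by (auto simp: smooth_map_def Let_def)

lemma smooth_mapI:
  assumes "U \<subseteq> points M" "f ` U \<subseteq> points N"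
    and "\<And>c d. c \<in> atlas M \<Longrightarrow> d \<in> atlas N \<Longrightarrow> open (chart_rep_dom c d U f)"
    and "\<And>c d. c \<in> atlas M \<Longrightarrow> d \<in> atlas N \<Longrightarrow> smooth_on (chart_rep_dom c d U f) (chart_rep c d f)"
  shows "smooth_map M U N f"
  using assms by (auto simp: smooth_map_def Let_def)

lemma smooth_map_cong:
  assumes M: "smooth_atlas M" and f: "smooth_map M U N f" and eq: "\<And>p. p \<in> U \<Longrightarrow> f p = g p"
  shows "smooth_map M U N g"
proof (rule smooth_mapI)
  show "U \<subseteq> points M" "g ` U \<subseteq> points N" using smooth_mapD(1,2)[OF f] eq by auto
  fix c d assume cd: "c \<in> atlas M" "d \<in> atlas N"
  have dom: "chart_rep_dom c d U g = chart_rep_dom c d U f" using eq by auto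
  show op: "open (chart_rep_dom c d U g)" unfolding dom using smooth_mapD(3)[OF f] cd by blast
  show "smooth_on (chart_rep_dom c d U g) (chart_rep c d g)"
    by (rule smooth_on_cong[OF op, of "chart_rep c d f"])
      (use smooth_mapD(4)[OF f cd] dom eq cd in \<open>auto simp: smooth_atlas_simps[OF M]\<close>)
qed

text \<open>\<open>smooth_map\<close> speaks of all pairs of charts. One good pair around each point
  suffices, since any other representation differs from it by transition maps on both sides.\<close>

lemma smooth_mapI_local:
  assumes M: "smooth_atlas M" and N: "smooth_atlas N" and U: "U \<subseteq> points M"
    and loc: "\<And>p. p \<in> U \<Longrightarrow> \<exists>c\<in>atlas M. \<exists>d\<in>atlas N. \<exists>W. open W \<and> p \<in> chart_dom c \<and> coord c p \<in> W \<and>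
      W \<subseteq> chart_rep_dom c d U f \<and> smooth_on W (chart_rep c d f)"
  shows "smooth_map M U N f"
proof -
  have nbhd: "\<exists>B. open B \<and> coord c' p \<in> B \<and> B \<subseteq> chart_rep_dom c' d' U f \<and> smooth_on B (chart_rep c' d' f)"
    if c': "c' \<in> atlas M" and d': "d' \<in> atlas N" and p: "p \<in> U" "p \<in> chart_dom c'" "f p \<in> chart_dom d'"
    for c' d' p
  proof -
    obtain c d W where c: "c \<in> atlas M" and d: "d \<in> atlas N" and W: "open W" "coord c p \<in> W"
      and pc: "p \<in> chart_dom c"
      and WU: "W \<subseteq> chart_rep_dom c d U f" and sW: "smooth_on W (chart_rep c d f)"
      using loc[OF p(1)] by blast
    have inv: "coord_inv c x \<in> U \<and> coord_inv c x \<in> chart_dom c \<and> f (coord_inv c x) \<in> chart_dom d \<and>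
        coord c (coord_inv c x) = x" if "x \<in> W" for x
      using WU that c by (auto simp: smooth_atlas_simps[OF M])
    \<comment> \<open>\<open>W2\<close> is the part of \<open>W\<close> that the known
      representation sends into the overlap of \<open>d\<close> and \<open>d'\<close>, and
      \<open>B\<close> is this part seen from \<open>c'\<close>. Both are open as preimages, and on
      \<open>B\<close> the wanted representation is transition, known representation,
      transition.\<close>
    define D where "D = coord d ` (chart_dom d \<inter> chart_dom d')"
    define C where "C = coord c' ` (chart_dom c' \<inter> chart_dom c)"
    define W2 where "W2 = W \<inter> chart_rep c d f -` D"
    define B where "B = C \<inter> (coord c \<circ> coord_inv c') -` W2"
    have sC: "smooth_on C (coord c \<circ> coord_inv c')"
      unfolding C_def by (rule smooth_on_transition[OF M c' c])
    have sD: "smooth_on D (coord d' \<circ> coord_inv d)"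
      unfolding D_def by (rule smooth_on_transition[OF N d d'])
    have oD: "open D" unfolding D_def by (rule open_coord_Int[OF N d d'])
    have oW2: "open W2" unfolding W2_def
      by (rule continuous_open_preimage[OF smooth_on_imp_continuous_on[OF sW] W(1) oD])
    have oB: "open B" unfolding B_def
      by (rule continuous_open_preimage[OF smooth_on_imp_continuous_on[OF sC] _ oW2])
        (simp add: C_def open_coord_Int[OF M c' c])
    have B: "\<exists>q\<in>U. x = coord c' q \<and> q \<in> chart_dom c' \<and> q \<in> chart_dom c \<and> f q \<in> chart_dom d \<and> f q \<in> chart_dom d' \<and> coord c q \<in> W2"
      if xB: "x \<in> B" for x
    proof -
      obtain q where q: "x = coord c' q" "q \<in> chart_dom c'" "q \<in> chart_dom c" "coord c q \<in> W2"
        using xB c' by (auto simp: B_def C_def smooth_atlas_simps[OF M])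
      have qW: "coord c q \<in> W" "coord d (f q) \<in> D" using q c by (auto simp: W2_def smooth_atlas_simps[OF M])
      have "q \<in> U" "f q \<in> chart_dom d" using inv[OF qW(1)] q c by (auto simp: smooth_atlas_simps[OF M])
      moreover have "f q \<in> chart_dom d'"
        using qW(2) \<open>f q \<in> chart_dom d\<close> inj_on_coord[OF N d] by (auto simp: D_def dest: inj_onD)
      ultimately show ?thesis using q by blast
    qed
    have "f p \<in> chart_dom d" using inv[OF W(2)] c pc by (simp add: smooth_atlas_simps[OF M])
    then have "coord c' p \<in> B"
      using p pc W c c' by (auto simp: B_def C_def W2_def D_def smooth_atlas_simps[OF M])
    moreover have "B \<subseteq> chart_rep_dom c' d' U f" using B by fastforce
    moreover have "smooth_on B (chart_rep c' d' f)"
    proof (rule smooth_on_cong[OF oB])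
      have s1: "smooth_on B (coord c \<circ> coord_inv c')" by (rule smooth_on_subset[OF sC]) (auto simp: B_def)
      have s2: "smooth_on W2 (chart_rep c d f)" by (rule smooth_on_subset[OF sW]) (auto simp: W2_def)
      have s3: "smooth_on W2 (\<lambda>x. (coord d' \<circ> coord_inv d) (chart_rep c d f x))"
        by (rule smooth_on_compose[OF oW2 oD _ s2 sD]) (auto simp: W2_def)
      show "smooth_on B (\<lambda>x. (coord d' \<circ> coord_inv d) (chart_rep c d f ((coord c \<circ> coord_inv c') x)))"
        by (rule smooth_on_compose[OF oB oW2 _ s1 s3]) (auto simp: B_def)
      fix x assume "x \<in> B"
      from B[OF this] show "(coord d' \<circ> coord_inv d) (chart_rep c d f ((coord c \<circ> coord_inv c') x)) = chart_rep c' d' f x"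
        using c c' d by (auto simp: smooth_atlas_simps[OF M] smooth_atlas_simps[OF N])
    qed
    ultimately show ?thesis using oB by blast
  qed
  show ?thesis
  proof (rule smooth_mapI[OF U])
    show "f ` U \<subseteq> points N"
    proof safe
      fix p assume "p \<in> U"
      from loc[OF this] obtain c d W where "c \<in> atlas M" "d \<in> atlas N" "p \<in> chart_dom c"
        "coord c p \<in> chart_rep_dom c d U f" by blast
      then have "f p \<in> chart_dom d" using inj_on_coord[OF M] by (auto dest: inj_onD)
      then show "f p \<in> points N" using \<open>d \<in> atlas N\<close> chart_dom_points[OF N] by blast
    qed
    fix c d assume cd: "c \<in> atlas M" "d \<in> atlas N"
    show "open (chart_rep_dom c d U f)"
      by (subst open_subopen) (use nbhd[OF cd] in blast)
    show "smooth_on (chart_rep_dom c d U f) (chart_rep c d f)"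
      by (rule smooth_on_local) (use nbhd[OF cd] in blast)
  qed
qed

section \<open>Tangent maps in arbitrary charts\<close>

text \<open>\<open>tangent_map\<close> is encoded in the preferred charts at the point and at its
  image. The composite \<open>coord d \<circ> f \<circ> coord_inv e\<close> factors through the
  preferred target chart and also through \<open>c\<close>; the chain rule for the two
  factorisations gives the two sides.\<close>

lemma coord_tangent_map:
  assumes M: "smooth_atlas M" and N: "smooth_atlas N" and f: "smooth_map M U N f"
    and c: "c \<in> atlas M" and d: "d \<in> atlas N"
    and p: "fst \<xi> \<in> U" "fst \<xi> \<in> chart_dom c" "f (fst \<xi>) \<in> chart_dom d"
  shows "coord (tangent_chart N d) (tangent_map M N f \<xi>) =
    tangent_fun (chart_rep c d f) (coord (tangent_chart M c) \<xi>)"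
proof -
  obtain p v where \<xi>: "\<xi> = (p, v)" by (cases \<xi>)
  let ?e = "chart_at M p" and ?e' = "chart_at N (f p)"
  have pts: "p \<in> points M" "f p \<in> points N" using smooth_mapD(1,2)[OF f] p \<xi> by auto
  then have at: "?e \<in> atlas M" "?e' \<in> atlas N" by (simp_all add: smooth_atlas_simps[OF M] smooth_atlas_simps[OF N])
  have pp: "p \<in> U" "p \<in> chart_dom c" "f p \<in> chart_dom d" "p \<in> chart_dom ?e" "f p \<in> chart_dom ?e'"
    using p pts by (simp_all add: \<xi> smooth_atlas_simps[OF M] smooth_atlas_simps[OF N])
  let ?x = "coord ?e p"
  \<comment> \<open>Here both factorisations are meaningful: the point lies in both source charts
    and its image in both target charts.\<close>
  let ?B = "chart_rep_dom ?e ?e' U f \<inter> chart_rep_dom ?e d U f \<inter> coord ?e ` (chart_dom ?e \<inter> chart_dom c)"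
  have df: "chart_rep ?e ?e' f differentiable at ?x"
    by (rule smooth_on_differentiable[OF smooth_mapD(4)[OF f at]]) (use pp in auto)
  have dd: "(coord d \<circ> coord_inv ?e') differentiable at (coord ?e' (f p))"
    using transition_differentiable[OF N at(2) d] pp by blast
  have df': "chart_rep c d f differentiable at (coord c p)"
    by (rule smooth_on_differentiable[OF smooth_mapD(4)[OF f c d]]) (use pp in auto)
  have dc: "(coord c \<circ> coord_inv ?e) differentiable at ?x"
    using transition_differentiable[OF M at(1) c] pp by blast
  have "coord (tangent_chart N d) (tangent_map M N f \<xi>) =
      tangent_fun (coord d \<circ> coord_inv ?e') (tangent_fun (chart_rep ?e ?e' f) (?x, v))"
    unfolding \<xi> tangent_map_def using pp at d
    by (simp add: coord_tangent_chart_tangent_fun[OF N] tangent_fun_Pair[of "chart_rep _ _ _"] smooth_atlas_simps[OF M])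
  also have "\<dots> = tangent_fun ((coord d \<circ> coord_inv ?e') \<circ> chart_rep ?e ?e' f) (?x, v)"
    by (rule tangent_fun_compose[symmetric]) (use df dd pp at in \<open>simp_all add: smooth_atlas_simps[OF M]\<close>)
  also have "\<dots> = tangent_fun (chart_rep c d f \<circ> (coord c \<circ> coord_inv ?e)) (?x, v)"
  proof (rule tangent_fun_cong[where A = ?B])
    show "open ?B" using smooth_mapD(3)[OF f] at d c by (intro open_Int open_coord_Int[OF M]) auto
    show "fst (?x, v) \<in> ?B" using pp by auto
    have "((coord d \<circ> coord_inv ?e') \<circ> chart_rep ?e ?e' f) differentiable at ?x"
      by (rule differentiable_chain_at[OF df]) (use dd pp at in \<open>simp add: smooth_atlas_simps[OF M]\<close>)
    then show "((coord d \<circ> coord_inv ?e') \<circ> chart_rep ?e ?e' f) differentiable at (fst (?x, v))" by simp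
    fix x assume x: "x \<in> ?B"
    then obtain q where q: "x = coord ?e q" "q \<in> chart_dom ?e" "f q \<in> chart_dom ?e'" by auto
    moreover have "q \<in> chart_dom c" using x q inj_on_coord[OF M at(1)] by (auto dest: inj_onD)
    ultimately show "((coord d \<circ> coord_inv ?e') \<circ> chart_rep ?e ?e' f) x =
        (chart_rep c d f \<circ> (coord c \<circ> coord_inv ?e)) x"
      using at c d by (simp add: smooth_atlas_simps[OF M] smooth_atlas_simps[OF N])
  qed
  also have "\<dots> = tangent_fun (chart_rep c d f) (tangent_fun (coord c \<circ> coord_inv ?e) (?x, v))"
    by (rule tangent_fun_compose) (use df' dc pp at in \<open>simp_all add: smooth_atlas_simps[OF M]\<close>)
  also have "tangent_fun (coord c \<circ> coord_inv ?e) (?x, v) = coord (tangent_chart M c) \<xi>"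
    unfolding \<xi> using coord_tangent_chart_tangent_fun[OF M c pp(2)] by simp
  finally show ?thesis .
qed

section \<open>The canonical flip in coordinates\<close>

text \<open>The transition between two induced charts is compared with \<open>tangent_fun\<close> of
  the base transition over the overlap \<open>?V\<close>; since \<open>?V \<times> UNIV\<close> is
  open, the comparison survives another derivative.\<close>

lemma coord_second_tangent_chart_change:
  assumes N: "smooth_atlas N" and c: "c \<in> atlas N" "d \<in> atlas N"
    and z: "fst (fst z) \<in> chart_dom c" "fst (fst z) \<in> chart_dom d"
  shows "coord (tangent_chart (tangent_bundle N) (tangent_chart N d)) z =
    tangent_fun (tangent_fun (coord d \<circ> coord_inv c)) (coord (tangent_chart (tangent_bundle N) (tangent_chart N c)) z)"
proof -
  note TN = smooth_atlas_tangent_bundle[OF N]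
  let ?c = "tangent_chart N c" and ?d = "tangent_chart N d"
  let ?V = "coord c ` (chart_dom c \<inter> chart_dom d)"
  let ?z = "coord (tangent_chart (tangent_bundle N) ?c) z"
  have fz: "fst ?z = coord ?c (fst z)" by simp
  have dom: "fst z \<in> chart_dom ?c" "fst z \<in> chart_dom ?d" using z by (simp_all add: mem_Times_iff)
  have "coord (tangent_chart (tangent_bundle N) ?d) z = tangent_fun (coord ?d \<circ> coord_inv ?c) ?z"
    by (rule coord_tangent_chart_change[OF TN]) (use c dom in auto)
  also have "\<dots> = tangent_fun (tangent_fun (coord d \<circ> coord_inv c)) ?z"
  proof (rule tangent_fun_cong[where A = "?V \<times> UNIV"])
    show "open (?V \<times> (UNIV :: 'b set))" by (simp add: open_Times open_coord_Int[OF N c])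
    show "fst ?z \<in> ?V \<times> UNIV" using z by (auto simp: mem_Times_iff)
    show "(coord ?d \<circ> coord_inv ?c) differentiable at (fst ?z)"
      unfolding fz using transition_differentiable[OF TN _ _ dom] c by simp
    fix x assume "x \<in> ?V \<times> (UNIV :: 'b set)"
    then have "x \<in> coord ?c ` ((chart_dom c \<inter> chart_dom d) \<times> UNIV)"
      using image_coord_tangent_chart[OF N c(1), of "chart_dom c \<inter> chart_dom d"] by simp
    then obtain \<xi> where \<xi>: "x = coord ?c \<xi>" "fst \<xi> \<in> chart_dom c" "fst \<xi> \<in> chart_dom d" by auto
    then have "coord_inv ?c x = \<xi>"
      using coord_inv_coord[OF TN, of ?c \<xi>] c by (simp add: mem_Times_iff)
    then show "(coord ?d \<circ> coord_inv ?c) x = tangent_fun (coord d \<circ> coord_inv c) x"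
      using coord_tangent_chart_change[OF N c \<xi>(2,3)] \<xi>(1) by simp
  qed
  finally show ?thesis .
qed

lemma coord_second_tangent_chart_at:
  assumes "smooth_atlas N" "p \<in> points N"
  shows "coord (tangent_chart (tangent_bundle N) (tangent_chart N (chart_at N p))) ((p, y), \<eta>) =
    ((coord (chart_at N p) p, y), \<eta>)"
  using coord_tangent_chart_at[OF smooth_atlas_tangent_bundle, of N "(p, y)" \<eta>] assms
  by (simp add: coord_tangent_chart_at)

text \<open>In the preferred chart of the foot point both flips exchange the same two entries. Any
  other chart differs by a double tangent map, and these commute with \<open>flip\<close>.\<close>

lemma coord_flip:
  assumes N: "smooth_atlas N" and c: "c \<in> atlas N" "fst (fst z) \<in> chart_dom c"
  shows "coord (tangent_chart (tangent_bundle N) (tangent_chart N c)) (flip z) =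
    flip (coord (tangent_chart (tangent_bundle N) (tangent_chart N c)) z)"
proof -
  obtain p y X Y where z: "z = ((p, y), (X, Y))" by (metis prod.collapse)
  have p: "p \<in> chart_dom c" "p \<in> points N" using c z chart_dom_points[OF N c] by auto
  let ?e = "chart_at N p"
  have e: "?e \<in> atlas N" "p \<in> chart_dom ?e" using p by (simp_all add: smooth_atlas_simps[OF N])
  have *: "coord (tangent_chart (tangent_bundle N) (tangent_chart N c)) ((p, y), (X, Y)) =
      tangent_fun (tangent_fun (coord c \<circ> coord_inv ?e)) ((coord ?e p, y), (X, Y))" for y X Y
    using coord_second_tangent_chart_change[OF N e(1) c(1), of "((p, y), (X, Y))"] e p
    by (simp add: coord_second_tangent_chart_at[OF N])
  show ?thesis
    unfolding z flip_Pair *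
    by (subst flip_tangent_fun_tangent_fun[OF open_coord_Int[OF N e(1) c(1)] smooth_on_transition[OF N e(1) c(1)]])
      (use p e in auto)
qed

lemma smooth_map_flip:
  assumes N: "smooth_atlas N"
  shows "smooth_map (tangent_bundle (tangent_bundle N)) (points (tangent_bundle (tangent_bundle N)))
    (tangent_bundle (tangent_bundle N)) flip"
proof (rule smooth_mapI_local)
  note TTN = smooth_atlas_tangent_bundle[OF smooth_atlas_tangent_bundle[OF N]]
  show "smooth_atlas (tangent_bundle (tangent_bundle N))" "smooth_atlas (tangent_bundle (tangent_bundle N))"
    using TTN by simp_all
  fix \<xi> assume "\<xi> \<in> points (tangent_bundle (tangent_bundle N))"
  then have p: "fst (fst \<xi>) \<in> points N" by auto
  let ?e = "chart_at N (fst (fst \<xi>))"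
  let ?c = "tangent_chart (tangent_bundle N) (tangent_chart N ?e)"
  have e: "?e \<in> atlas N" "fst (fst \<xi>) \<in> chart_dom ?e" using p by (simp_all add: smooth_atlas_simps[OF N])
  have c: "?c \<in> atlas (tangent_bundle (tangent_bundle N))" "\<xi> \<in> chart_dom ?c"
    using e by (auto simp: mem_Times_iff)
  let ?W = "coord ?c ` chart_dom ?c"
  have W: "open ?W" by (rule open_coord_dom[OF TTN c(1)])
  have flip_dom: "flip \<eta> \<in> chart_dom ?c \<longleftrightarrow> \<eta> \<in> chart_dom ?c" for \<eta>
    by (cases \<eta>) (auto simp: flip_def)
  have dom: "chart_dom ?c \<subseteq> points (tangent_bundle (tangent_bundle N))"
    using chart_dom_points[OF TTN c(1)] by blast
  have "smooth_on ?W (chart_rep ?c ?c flip)"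
  proof (rule smooth_on_cong[OF W _ smooth_on_linear[OF bounded_linear_flip W]])
    fix x assume "x \<in> ?W"
    then obtain \<eta> where \<eta>: "x = coord ?c \<eta>" "\<eta> \<in> chart_dom ?c" by blast
    then have "fst (fst \<eta>) \<in> chart_dom ?e" by auto
    then show "flip x = chart_rep ?c ?c flip x"
      using coord_flip[OF N e(1)] coord_inv_coord[OF TTN c(1)] \<eta> by simp
  qed
  moreover have "?W \<subseteq> chart_rep_dom ?c ?c (points (tangent_bundle (tangent_bundle N))) flip"
    using flip_dom dom by blast
  ultimately show "\<exists>c\<in>atlas (tangent_bundle (tangent_bundle N)). \<exists>d\<in>atlas (tangent_bundle (tangent_bundle N)).
      \<exists>W. open W \<and> \<xi> \<in> chart_dom c \<and> coord c \<xi> \<in> W \<and>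
        W \<subseteq> chart_rep_dom c d (points (tangent_bundle (tangent_bundle N))) flip \<and> smooth_on W (chart_rep c d flip)"
    using c W by blast
qed simp

section \<open>Velocities and second velocities\<close>

text \<open>\<open>velocity\<close> uses the preferred chart at \<open>\<gamma> t\<close>, while
  \<open>y\<close> is computed in \<open>d\<close>. The transition \<open>?\<tau>\<close> converts
  \<open>y\<close> into the encoded vector, and the induced chart of \<open>d\<close> converts it
  back.\<close>

lemma coord_velocity:
  assumes N: "smooth_atlas N" and d: "d \<in> atlas N"
    and ev: "eventually (\<lambda>s. \<gamma> s \<in> chart_dom d) (nhds t)"
    and der: "((\<lambda>s. coord d (\<gamma> s)) has_vector_derivative y) (at t)"
  shows "coord (tangent_chart N d) (velocity N \<gamma> t) = (coord d (\<gamma> t), y)"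
proof -
  let ?e = "chart_at N (\<gamma> t)"
  have p: "\<gamma> t \<in> chart_dom d" using ev eventually_nhds_x_imp_x by blast
  have e: "?e \<in> atlas N" "\<gamma> t \<in> chart_dom ?e"
    using chart_dom_points[OF N d p] by (simp_all add: smooth_atlas_simps[OF N])
  let ?\<tau> = "coord ?e \<circ> coord_inv d"
  let ?w = "frechet_derivative ?\<tau> (at (coord d (\<gamma> t))) y"
  have d\<tau>: "?\<tau> differentiable at (coord d (\<gamma> t))" by (rule transition_differentiable[OF N d e(1) p e(2)])
  obtain T where T: "open T" "t \<in> T" "\<And>s. s \<in> T \<Longrightarrow> \<gamma> s \<in> chart_dom d"
    using ev unfolding eventually_nhds by blast
  have "((\<lambda>s. ?\<tau> (coord d (\<gamma> s))) has_derivative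
      (\<lambda>h. frechet_derivative ?\<tau> (at (coord d (\<gamma> t))) (h *\<^sub>R y))) (at t)"
    using diff_chain_at[OF der[unfolded has_vector_derivative_def] d\<tau>[unfolded frechet_derivative_works]]
    by (simp add: o_def)
  then have "((\<lambda>s. ?\<tau> (coord d (\<gamma> s))) has_vector_derivative ?w) (at t)"
    using linear_scale[OF linear_frechet_derivative[OF d\<tau>]] by (simp add: has_vector_derivative_def)
  then have "((\<lambda>s. coord ?e (\<gamma> s)) has_vector_derivative ?w) (at t)"
    by (rule has_vector_derivative_transform_within_open[OF _ T(1,2)])
      (use T(3) in \<open>simp add: smooth_atlas_simps[OF N] d\<close>)
  then have "velocity N \<gamma> t = (\<gamma> t, ?w)"
    by (simp add: velocity_def o_def vector_derivative_at)
  then have "coord (tangent_chart N d) (velocity N \<gamma> t) =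
      tangent_fun (coord d \<circ> coord_inv ?e) (tangent_fun ?\<tau> (coord d (\<gamma> t), y))"
    by (simp add: coord_tangent_chart_tangent_fun[OF N d p] tangent_fun_Pair[of ?\<tau>] smooth_atlas_simps[OF N] d p)
  also have "\<dots> = (coord d (\<gamma> t), y)"
    using tangent_transition_compose[OF N d e(1) d p e(2) p] tangent_transition_self[OF N d p] by simp
  finally show ?thesis .
qed

lemma coord_inv_euclidean [simp]: "coord_inv (Chart UNIV id) = id"
proof
  show "coord_inv (Chart UNIV id) x = id x" for x :: 'a
    using the_inv_into_f_f[of id UNIV x] by (simp add: coord_inv_def)
qed

lemma smooth_atlas_euclidean: "smooth_atlas (euclidean_manifold :: ('e::euclidean_space, 'e) manifold)"
proof -
  have "smooth_on UNIV (id :: 'e \<Rightarrow> 'e)"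
    unfolding id_def by (rule smooth_on_linear[OF bounded_linear_ident open_UNIV])
  then show ?thesis by (simp add: smooth_atlas_def euclidean_manifold_def)
qed

lemma smooth_map_euclideanD:
  assumes "smooth_map euclidean_manifold U N f" "d \<in> atlas N"
  shows "open {x \<in> U. f x \<in> chart_dom d}" "smooth_on {x \<in> U. f x \<in> chart_dom d} (\<lambda>x. coord d (f x))"
  using smooth_mapD(3,4)[OF assms(1), of "Chart UNIV id" d] assms(2)
  by (simp_all add: euclidean_manifold_def o_def)

lemma smooth_on_line_derivative:
  assumes "smooth_on A g" "a + s *\<^sub>R v \<in> A"
  shows "((\<lambda>s. g (a + s *\<^sub>R v)) has_vector_derivative frechet_derivative g (at (a + s *\<^sub>R v)) v) (at s)"
proof -
  note dg = smooth_on_has_derivative[OF assms]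
  have "((\<lambda>s. a + s *\<^sub>R v) has_derivative (\<lambda>h. h *\<^sub>R v)) (at s)"
    by (auto intro!: derivative_eq_intros)
  from diff_chain_at[OF this dg] show ?thesis
    using linear_scale[OF has_derivative_linear[OF dg]] by (simp add: has_vector_derivative_def o_def)
qed

text \<open>The directions \<open>u\<close> and \<open>w\<close> are kept general so that both
  orders of differentiation in the definition of the flip are instances, with \<open>(1, 0)\<close>
  and \<open>(0, 1)\<close> exchanged.\<close>

lemma second_velocity:
  fixes u w :: "'d::euclidean_space"
  assumes N: "smooth_atlas N" and c: "smooth_map euclidean_manifold U N c"
    and z: "z = s *\<^sub>R u + t *\<^sub>R w" "z \<in> U"
    and g: "g = (\<lambda>z'. coord (chart_at N (c z)) (c z'))"
  shows "velocity (tangent_bundle N) (\<lambda>t. velocity N (\<lambda>s. c (s *\<^sub>R u + t *\<^sub>R w)) s) t =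
    ((c z, frechet_derivative g (at z) u),
     (frechet_derivative g (at z) w,
      frechet_derivative (\<lambda>z. frechet_derivative g (at z) u) (at z) w))"
proof -
  let ?e = "chart_at N (c z)"
  have "c z \<in> points N" using smooth_mapD(2)[OF c] z by blast
  then have e: "?e \<in> atlas N" "c z \<in> chart_dom ?e" by (simp_all add: smooth_atlas_simps[OF N])
  let ?W = "{x \<in> U. c x \<in> chart_dom ?e}"
  have W: "open ?W" "smooth_on ?W g" using smooth_map_euclideanD[OF c e(1)] by (simp_all add: g)
  have zW: "z \<in> ?W" using z e by simp
  have line: "\<exists>T. open T \<and> t \<in> T \<and> (\<forall>s\<in>T. a + s *\<^sub>R v \<in> ?W)" if "a + t *\<^sub>R v \<in> ?W" for a v t
  proof -
    have "open ((\<lambda>s. a + s *\<^sub>R v) -` ?W)"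
      by (rule open_vimage[OF W(1)]) (intro continuous_intros)
    then show ?thesis using that by blast
  qed
  \<comment> \<open>The outer velocity differentiates in \<open>t\<close>, but the preferred chart
    at the moving foot point may jump. The inner velocity is therefore first expressed in the single
    chart \<open>?e\<close> for all parameters that stay in it.\<close>
  have vel: "coord (tangent_chart N ?e) (velocity N (\<lambda>s. c (s *\<^sub>R u + t' *\<^sub>R w)) s) =
      (g (s *\<^sub>R u + t' *\<^sub>R w), frechet_derivative g (at (s *\<^sub>R u + t' *\<^sub>R w)) u)"
    if "s *\<^sub>R u + t' *\<^sub>R w \<in> ?W" for t'
  proof -
    have in_W: "t' *\<^sub>R w + s *\<^sub>R u \<in> ?W" using that by (simp add: add.commute)
    obtain T where T: "open T" "s \<in> T" "\<forall>s\<in>T. t' *\<^sub>R w + s *\<^sub>R u \<in> ?W" using line[OF in_W] by blast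
    then have "eventually (\<lambda>s. c (s *\<^sub>R u + t' *\<^sub>R w) \<in> chart_dom ?e) (nhds s)"
      unfolding eventually_nhds by (intro exI[of _ T]) (simp add: add.commute)
    moreover have "((\<lambda>s. coord ?e (c (s *\<^sub>R u + t' *\<^sub>R w))) has_vector_derivative
        frechet_derivative g (at (s *\<^sub>R u + t' *\<^sub>R w)) u) (at s)"
      using smooth_on_line_derivative[OF W(2) in_W] by (simp add: g add.commute)
    ultimately show ?thesis using coord_velocity[OF N e(1)] by (simp add: g)
  qed
  have "s *\<^sub>R u + t *\<^sub>R w \<in> ?W" using zW z by simp
  from vel[OF this] have "coord (tangent_chart N ?e) (velocity N (\<lambda>s. c (s *\<^sub>R u + t *\<^sub>R w)) s) =
      (coord ?e (c z), frechet_derivative g (at z) u)"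
    by (simp add: z(1)[symmetric] g)
  moreover have "velocity N (\<lambda>s. c (s *\<^sub>R u + t *\<^sub>R w)) s =
      (c z, snd (velocity N (\<lambda>s. c (s *\<^sub>R u + t *\<^sub>R w)) s))"
    by (simp add: velocity_def z(1))
  ultimately have vel_z: "velocity N (\<lambda>s. c (s *\<^sub>R u + t *\<^sub>R w)) s = (c z, frechet_derivative g (at z) u)"
    using coord_tangent_chart_at[OF N \<open>c z \<in> points N\<close>] by (metis prod.inject)
  obtain T where T: "open T" "t \<in> T" "\<forall>t\<in>T. s *\<^sub>R u + t *\<^sub>R w \<in> ?W" using line zW z by blast
  have "((\<lambda>t. (g (s *\<^sub>R u + t *\<^sub>R w), frechet_derivative g (at (s *\<^sub>R u + t *\<^sub>R w)) u)) has_vector_derivative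
      (frechet_derivative g (at z) w, frechet_derivative (\<lambda>z. frechet_derivative g (at z) u) (at z) w)) (at t)"
    using zW z by (auto intro!: has_vector_derivative_Pair smooth_on_line_derivative[OF W(2)]
        smooth_on_line_derivative[OF smooth_on_derivative[OF W(2)]])
  then have "((\<lambda>t. coord (tangent_chart N ?e) (velocity N (\<lambda>s. c (s *\<^sub>R u + t *\<^sub>R w)) s)) has_vector_derivative
      (frechet_derivative g (at z) w, frechet_derivative (\<lambda>z. frechet_derivative g (at z) u) (at z) w)) (at t)"
    by (rule has_vector_derivative_transform_within_open[OF _ T(1,2)]) (use vel T(3) in simp)
  from vector_derivative_at[OF this] show ?thesis
    unfolding velocity_def[of "tangent_bundle N"] vel_z by (simp add: o_def)
qed

lemma second_velocity_flip:
  assumes N: "smooth_atlas N" and c: "smooth_map euclidean_manifold U N c" and z: "(t, s) \<in> U"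
  shows "velocity (tangent_bundle N) (\<lambda>t. velocity N (\<lambda>s. c (t, s)) s) t =
    flip (velocity (tangent_bundle N) (\<lambda>s. velocity N (\<lambda>t. c (t, s)) t) s)"
proof -
  let ?g = "\<lambda>z'. coord (chart_at N (c (t, s))) (c z')"
  let ?W = "{x \<in> U. c x \<in> chart_dom (chart_at N (c (t, s)))}"
  have "c (t, s) \<in> points N" using smooth_mapD(2)[OF c] z by blast
  then have e: "chart_at N (c (t, s)) \<in> atlas N" "(t, s) \<in> ?W" using z by (simp_all add: smooth_atlas_simps[OF N])
  have 1: "velocity (tangent_bundle N) (\<lambda>s. velocity N (\<lambda>t. c (t, s)) t) s =
    ((c (t, s), frechet_derivative ?g (at (t, s)) (1, 0)),
     (frechet_derivative ?g (at (t, s)) (0, 1),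
      frechet_derivative (\<lambda>z. frechet_derivative ?g (at z) (1, 0)) (at (t, s)) (0, 1)))"
    using second_velocity[OF N c _ z refl, of t "(1, 0)" s "(0, 1)"] by simp
  have 2: "velocity (tangent_bundle N) (\<lambda>t. velocity N (\<lambda>s. c (t, s)) s) t =
    ((c (t, s), frechet_derivative ?g (at (t, s)) (0, 1)),
     (frechet_derivative ?g (at (t, s)) (1, 0),
      frechet_derivative (\<lambda>z. frechet_derivative ?g (at z) (0, 1)) (at (t, s)) (1, 0)))"
    using second_velocity[OF N c _ z refl, of s "(0, 1)" t "(1, 0)"] by simp
  show ?thesis
    unfolding 1 2 flip_Pair
    using second_derivative_symmetric[OF smooth_map_euclideanD(2)[OF c e(1)] smooth_map_euclideanD(1)[OF c e(1)] e(2)]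
    by simp
qed

text \<open>
  In the preferred chart at \<open>p\<close> the map \<open>(t, s) \<mapsto> x + t y + s X + t s Y\<close> realises a prescribed second velocity;
  hence the defining property determines the flip.
\<close>

lemma second_velocity_surj:
  fixes N :: "('a, 'e::euclidean_space) manifold"
  assumes N: "smooth_atlas N" and z: "z \<in> points (tangent_bundle (tangent_bundle N))"
  obtains \<epsilon> :: real and c where "\<epsilon> > 0"
    "smooth_map euclidean_manifold ({-\<epsilon><..<\<epsilon>} \<times> {-\<epsilon><..<\<epsilon>}) N c"
    "velocity (tangent_bundle N) (\<lambda>s. velocity N (\<lambda>t. c (t, s)) 0) 0 = z"
proof -
  obtain p y X Y where zp: "z = ((p, y), (X, Y))" by (metis prod.collapse)
  have p: "p \<in> points N" using z zp by simp
  let ?e = "chart_at N p"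
  have e: "?e \<in> atlas N" "p \<in> chart_dom ?e" using p by (simp_all add: smooth_atlas_simps[OF N])
  define g :: "real \<times> real \<Rightarrow> 'e" where
    "g = (\<lambda>q. coord ?e p + fst q *\<^sub>R y + snd q *\<^sub>R X + (fst q * snd q) *\<^sub>R Y)"
  have bl: "bounded_linear (\<lambda>q. fst q *\<^sub>R v)" "bounded_linear (\<lambda>q. snd q *\<^sub>R v)" for v :: 'e
    by (rule bounded_linear_compose[OF bounded_linear_scaleR_left] bounded_linear_fst bounded_linear_snd)+
  have sg: "smooth_on A g" if "open A" for A
  proof -
    have "smooth_on A (\<lambda>q. (coord ?e p + fst q *\<^sub>R y + snd q *\<^sub>R X) + fst q *\<^sub>R (snd q *\<^sub>R Y))"
      by (intro smooth_on_add that smooth_on_const smooth_on_linear[OF bl(1) that] smooth_on_linear[OF bl(2) that]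
          smooth_on_linear[OF bounded_linear_fst that] smooth_on_bilinear[OF bounded_bilinear_scaleR that])
    then show ?thesis by (simp add: g_def)
  qed
  have "open (g -` (coord ?e ` chart_dom ?e))"
    using smooth_on_imp_continuous_on[OF sg[OF open_UNIV]]
    by (rule open_vimage[OF open_coord_dom[OF N e(1)]])
  moreover have "(0, 0) \<in> g -` (coord ?e ` chart_dom ?e)" using e by (simp add: g_def)
  ultimately obtain A B where AB: "open A" "open B" "(0, 0) \<in> A \<times> B" "A \<times> B \<subseteq> g -` (coord ?e ` chart_dom ?e)"
    by (rule open_prod_elim)
  then have "0 \<in> A" "0 \<in> B" by auto
  obtain r1 where "r1 > 0" "ball 0 r1 \<subseteq> A" using openE[OF AB(1) \<open>0 \<in> A\<close>] .
  moreover obtain r2 where "r2 > 0" "ball 0 r2 \<subseteq> B" using openE[OF AB(2) \<open>0 \<in> B\<close>] .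
  ultimately have r: "r1 > 0" "ball 0 r1 \<subseteq> A" "r2 > 0" "ball 0 r2 \<subseteq> B" by auto
  define \<epsilon> where "\<epsilon> = min r1 r2"
  have \<epsilon>: "\<epsilon> > 0" using r by (simp add: \<epsilon>_def)
  let ?Q = "{-\<epsilon><..<\<epsilon>} \<times> {-\<epsilon><..<\<epsilon>}"
  have "{-\<epsilon><..<\<epsilon>} \<subseteq> A" "{-\<epsilon><..<\<epsilon>} \<subseteq> B" using r by (auto simp: \<epsilon>_def subset_iff)
  then have Q: "?Q \<subseteq> g -` (coord ?e ` chart_dom ?e)" using AB(4) by blast
  have oQ: "open ?Q" by (simp add: open_Times)
  have Q0: "(0, 0) \<in> ?Q" using \<epsilon> by simp
  define c where "c = coord_inv ?e \<circ> g"
  have cdom: "c q \<in> chart_dom ?e \<and> coord ?e (c q) = g q" if qQ: "q \<in> ?Q" for q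
  proof -
    obtain r where "r \<in> chart_dom ?e" "g q = coord ?e r" using Q qQ by blast
    then show ?thesis using coord_inv_coord[OF N e(1)] by (simp add: c_def)
  qed
  have sm: "smooth_map euclidean_manifold ?Q N c"
  proof (rule smooth_mapI_local[OF smooth_atlas_euclidean N])
    show "?Q \<subseteq> points euclidean_manifold" by (simp add: points_def euclidean_manifold_def)
    fix q assume q: "q \<in> ?Q"
    let ?u = "Chart UNIV id :: (real \<times> real, real \<times> real) chart"
    have "smooth_on ?Q (chart_rep ?u ?e c)"
      by (rule smooth_on_cong[OF oQ _ sg[OF oQ]]) (simp add: cdom)
    moreover have "?Q \<subseteq> chart_rep_dom ?u ?e ?Q c" using cdom by auto
    moreover have "?u \<in> atlas euclidean_manifold" by (simp add: euclidean_manifold_def)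
    ultimately show "\<exists>u\<in>atlas euclidean_manifold. \<exists>d\<in>atlas N. \<exists>W. open W \<and> q \<in> chart_dom u \<and> coord u q \<in> W \<and>
        W \<subseteq> chart_rep_dom u d ?Q c \<and> smooth_on W (chart_rep u d c)"
      using oQ q e(1) by (intro bexI[of _ ?u] bexI[of _ ?e] exI[of _ ?Q]) auto
  qed
  have c0: "c (0, 0) = p" using e by (simp add: c_def g_def smooth_atlas_simps[OF N])
  let ?h = "\<lambda>q. coord ?e (c q)"
  have dh: "(?h has_derivative (\<lambda>h. fst h *\<^sub>R y + snd h *\<^sub>R X + (fst h * snd q + fst q * snd h) *\<^sub>R Y)) (at q)"
    if "q \<in> ?Q" for q
  proof (rule has_derivative_transform_within_open[OF _ oQ that])
    show "(g has_derivative (\<lambda>h. fst h *\<^sub>R y + snd h *\<^sub>R X + (fst h * snd q + fst q * snd h) *\<^sub>R Y)) (at q)"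
      unfolding g_def by (rule derivative_eq_intros refl)+ (simp add: algebra_simps)
  qed (simp add: cdom)
  have Dh: "frechet_derivative ?h (at q) h = fst h *\<^sub>R y + snd h *\<^sub>R X + (fst h * snd q + fst q * snd h) *\<^sub>R Y"
    if "q \<in> ?Q" for q h
    using fun_cong[OF frechet_derivative_at[OF dh[OF that], symmetric]] .
  \<comment> \<open>On the square the derivative in \<open>t\<close> is \<open>y + s Y\<close>; its
    slope in \<open>s\<close> is the remaining entry \<open>Y\<close>.\<close>
  have "((\<lambda>q. frechet_derivative ?h (at q) (1, 0)) has_derivative (\<lambda>h. snd h *\<^sub>R Y)) (at (0, 0))"
  proof (rule has_derivative_transform_within_open[OF _ oQ Q0])
    show "((\<lambda>q. y + snd q *\<^sub>R Y) has_derivative (\<lambda>h. snd h *\<^sub>R Y)) (at (0, 0))"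
      by (auto intro!: derivative_eq_intros)
  qed (simp add: Dh)
  from fun_cong[OF frechet_derivative_at[OF this, symmetric], of "(0, 1)"]
  have DDh: "frechet_derivative (\<lambda>q. frechet_derivative ?h (at q) (1, 0)) (at (0, 0)) (0, 1) = Y" by simp
  have "velocity (tangent_bundle N) (\<lambda>s. velocity N (\<lambda>t. c (t, s)) 0) 0 = z"
    using second_velocity[OF N sm _ Q0 refl, of 0 "(1, 0)" 0 "(0, 1)"]
    by (simp add: c0 Dh[OF Q0] DDh zp)
  then show thesis using that \<epsilon> sm by blast
qed

section \<open>Identification of the canonical flip\<close>

text \<open>Symmetry of mixed derivatives makes \<open>flip\<close>, cut down to the bundle for the
  sake of extensionality, a solution of the description. Every point of the bundle is a second
  velocity at the origin, so every other solution takes the same values there.\<close>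

theorem canonical_flip_eq_flip:
  fixes N :: "('a, 'e::euclidean_space) manifold"
  assumes N: "smooth_atlas N" and z: "z \<in> points (tangent_bundle (tangent_bundle N))"
  shows "canonical_flip N z = flip z"
proof -
  let ?T = "tangent_bundle (tangent_bundle N)"
  note TTN = smooth_atlas_tangent_bundle[OF smooth_atlas_tangent_bundle[OF N]]
  let ?k = "restrict flip (points ?T)"
  have vel_points: "velocity (tangent_bundle N) (\<lambda>s. velocity N (\<lambda>t. c (t, s)) t) s \<in> points ?T"
    if "smooth_map euclidean_manifold U N c" "(t, s) \<in> U" for U c t s
    using smooth_mapD(2)[OF that(1)] that(2) by (auto simp: velocity_def)
  have flip_points: "flip w \<in> points ?T \<longleftrightarrow> w \<in> points ?T" for w
    by (cases w) (auto simp: flip_def)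
  have bij: "bij_betw ?k (points ?T) (points ?T)"
    by (rule bij_betw_byWitness[of _ flip]) (use flip_points in auto)
  \<comment> \<open>An involution is its own inverse, so both smoothness conditions of a
    diffeomorphism reduce to \<open>smooth_map_flip\<close>.\<close>
  have inv: "the_inv_into (points ?T) ?k w = flip w" if "w \<in> points ?T" for w
    by (rule the_inv_into_f_eq) (use bij that flip_points in \<open>auto simp: bij_betw_def\<close>)
  have "canonical_flip N = ?k"
    unfolding canonical_flip_def
  proof (rule the_equality)
    show "?k \<in> extensional (points ?T) \<and> diffeomorphism ?T ?T ?k \<and>
     (\<forall>\<epsilon> c. \<epsilon> > 0 \<longrightarrow> smooth_map euclidean_manifold ({-\<epsilon><..<\<epsilon>} \<times> {-\<epsilon><..<\<epsilon>}) N c \<longrightarrow>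
        (\<forall>t\<in>{-\<epsilon><..<\<epsilon>}. \<forall>s\<in>{-\<epsilon><..<\<epsilon>}.
           velocity (tangent_bundle N) (\<lambda>t. velocity N (\<lambda>s. c (t, s)) s) t =
           ?k (velocity (tangent_bundle N) (\<lambda>s. velocity N (\<lambda>t. c (t, s)) t) s)))"
    proof (intro conjI allI impI ballI)
      show "diffeomorphism ?T ?T ?k"
        unfolding diffeomorphism_def
        by (intro conjI bij smooth_map_cong[OF TTN smooth_map_flip[OF N]]) (simp_all add: inv del: points_tangent_bundle)
      fix \<epsilon> :: real and c t s
      assume c: "smooth_map euclidean_manifold ({-\<epsilon><..<\<epsilon>} \<times> {-\<epsilon><..<\<epsilon>}) N c"
        and ts: "t \<in> {-\<epsilon><..<\<epsilon>}" "s \<in> {-\<epsilon><..<\<epsilon>}"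
      have "(t, s) \<in> {-\<epsilon><..<\<epsilon>} \<times> {-\<epsilon><..<\<epsilon>}" using ts by simp
      from second_velocity_flip[OF N c this] vel_points[OF c this]
      show "velocity (tangent_bundle N) (\<lambda>t. velocity N (\<lambda>s. c (t, s)) s) t =
           ?k (velocity (tangent_bundle N) (\<lambda>s. velocity N (\<lambda>t. c (t, s)) t) s)"
        by (simp only: restrict_apply if_True)
    qed simp
  next
    fix k
    assume k: "k \<in> extensional (points ?T) \<and> diffeomorphism ?T ?T k \<and>
     (\<forall>\<epsilon> c. \<epsilon> > 0 \<longrightarrow> smooth_map euclidean_manifold ({-\<epsilon><..<\<epsilon>} \<times> {-\<epsilon><..<\<epsilon>}) N c \<longrightarrow>
        (\<forall>t\<in>{-\<epsilon><..<\<epsilon>}. \<forall>s\<in>{-\<epsilon><..<\<epsilon>}.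
           velocity (tangent_bundle N) (\<lambda>t. velocity N (\<lambda>s. c (t, s)) s) t =
           k (velocity (tangent_bundle N) (\<lambda>s. velocity N (\<lambda>t. c (t, s)) t) s)))"
    show "k = ?k"
    proof (rule extensionalityI)
      show "k \<in> extensional (points ?T)" using k by blast
      show "?k \<in> extensional (points ?T)" by simp
      fix w assume w: "w \<in> points ?T"
      obtain \<epsilon> c where c: "\<epsilon> > 0" "smooth_map euclidean_manifold ({-\<epsilon><..<\<epsilon>} \<times> {-\<epsilon><..<\<epsilon>}) N c"
        "velocity (tangent_bundle N) (\<lambda>s. velocity N (\<lambda>t. c (t, s)) 0) 0 = w"
        by (rule second_velocity_surj[OF N w])
      have "0 \<in> {-\<epsilon><..<\<epsilon>}" using c(1) by simp
      then have "velocity (tangent_bundle N) (\<lambda>t. velocity N (\<lambda>s. c (t, s)) 0) 0 = k w"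
        using k c by metis
      moreover have "velocity (tangent_bundle N) (\<lambda>t. velocity N (\<lambda>s. c (t, s)) 0) 0 = flip w"
        using second_velocity_flip[OF N c(2), of 0 0] c(1,3) by simp
      ultimately show "k w = ?k w" using w by simp
    qed
  qed
  then show ?thesis using z by simp
qed

section \<open>Vector fields in coordinates\<close>

text \<open>\<open>x \<mapsto> D f x (v x)\<close> is the second component of
  \<open>tangent_fun f\<close> along the section \<open>x \<mapsto> (x, v x)\<close>, and the
  derivative of \<open>tangent_fun f\<close> is known.\<close>

lemma has_derivative_derivative_apply:
  assumes A: "open A" "z \<in> A" and f: "smooth_on A f" and v: "(v has_derivative v') (at z)"
  shows "((\<lambda>x. frechet_derivative f (at x) (v x)) has_derivative
    (\<lambda>h. frechet_derivative (\<lambda>x. frechet_derivative f (at x) (v z)) (at z) h + frechet_derivative f (at z) (v' h))) (at z)"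
proof -
  have "((\<lambda>x. (x, v x)) has_derivative (\<lambda>h. (h, v' h))) (at z)"
    by (intro has_derivative_Pair has_derivative_ident v)
  moreover have "(tangent_fun f has_derivative frechet_derivative (tangent_fun f) (at (z, v z))) (at (z, v z))"
    by (rule smooth_on_has_derivative[OF smooth_on_tangent_fun[OF A(1) f]]) (use A in simp)
  ultimately have "(tangent_fun f \<circ> (\<lambda>x. (x, v x)) has_derivative
      frechet_derivative (tangent_fun f) (at (z, v z)) \<circ> (\<lambda>h. (h, v' h))) (at z)"
    by (rule diff_chain_at)
  then have "((\<lambda>x. tangent_fun f (x, v x)) has_derivative
      (\<lambda>h. frechet_derivative (tangent_fun f) (at (z, v z)) (h, v' h))) (at z)"
    by (simp add: o_def)
  from bounded_linear.has_derivative[OF bounded_linear_snd this] show ?thesis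
    by (simp add: tangent_fun_Pair frechet_derivative_tangent_fun[OF A(1) f A(2)])
qed

text \<open>Naturality of the bracket under \<open>f\<close>: the second derivatives of \<open>f\<close> cancel by symmetry.\<close>

lemma bracket_natural:
  assumes A: "open A" "z \<in> A" and f: "smooth_on A f"
    and v: "(v has_derivative v') (at z)" and w: "(w has_derivative w') (at z)"
    and V: "(V has_derivative V') (at (f z))" and W: "(W has_derivative W') (at (f z))"
    and fv: "\<And>x. x \<in> A \<Longrightarrow> frechet_derivative f (at x) (v x) = V (f x)"
    and fw: "\<And>x. x \<in> A \<Longrightarrow> frechet_derivative f (at x) (w x) = W (f x)"
  shows "frechet_derivative f (at z) (w' (v z) - v' (w z)) = W' (V (f z)) - V' (W (f z))"
proof -
  let ?D = "frechet_derivative f (at z)"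
  let ?H = "\<lambda>u h. frechet_derivative (\<lambda>x. frechet_derivative f (at x) u) (at z) h"
  note df = smooth_on_has_derivative[OF f A(2)]
  \<comment> \<open>Derivative of the relation \<open>D f (u x) = U (f x)\<close> in direction
    \<open>h\<close>. Used for \<open>w\<close> along \<open>v\<close> and for \<open>v\<close>
    along \<open>w\<close>, it gives the two terms of the bracket, each with a second derivative of
    \<open>f\<close>.\<close>
  have *: "?H (u z) h + ?D (u' h) = U' (?D h)"
    if "(u has_derivative u') (at z)" "(U has_derivative U') (at (f z))"
      "\<And>x. x \<in> A \<Longrightarrow> frechet_derivative f (at x) (u x) = U (f x)" for u u' U U' h
  proof -
    have "((\<lambda>x. U (f x)) has_derivative (\<lambda>h. ?H (u z) h + ?D (u' h))) (at z)"
      by (rule has_derivative_transform_within_open[OF has_derivative_derivative_apply[OF A f that(1)] A])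
        (rule that(3))
    moreover have "((\<lambda>x. U (f x)) has_derivative (\<lambda>h. U' (?D h))) (at z)"
      using diff_chain_at[OF df that(2)] by (simp add: o_def)
    ultimately show ?thesis by (rule has_derivative_unique[THEN fun_cong])
  qed
  have W_eq: "?H (w z) (v z) + ?D (w' (v z)) = W' (V (f z))" using *[OF w W fw, of "v z"] fv[OF A(2)] by simp
  have V_eq: "?H (v z) (w z) + ?D (v' (w z)) = V' (W (f z))" using *[OF v V fv, of "w z"] fw[OF A(2)] by simp
  have sym: "?H (w z) (v z) = ?H (v z) (w z)" by (rule second_derivative_symmetric[OF f A])
  show ?thesis
    unfolding linear_diff[OF has_derivative_linear[OF df]] W_eq[symmetric] V_eq[symmetric] sym by simp
qed

lemma vector_field_on_coord:
  assumes N: "smooth_atlas N" and V: "vector_field_on N U V" and c: "c \<in> atlas N"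
    and p: "p \<in> U" "p \<in> chart_dom c"
  shows "coord (tangent_chart N c) (V p) = (coord c p, components N c V (coord c p))"
  using assms by (simp add: prod_eq_iff components_def vector_field_on_def smooth_atlas_simps[OF N])

text \<open>A vector field covers the identity, so its value lies over a chart exactly when its
  argument lies in it.\<close>

lemma vector_field_on_chart_rep_dom:
  assumes "vector_field_on N U V"
  shows "chart_rep_dom c (tangent_chart N c) U V = coord c ` (U \<inter> chart_dom c)"
  using assms by (intro arg_cong[of _ _ "image (coord c)"]) (auto simp: vector_field_on_def mem_Times_iff)

lemma vector_field_on_open:
  assumes "vector_field_on N U V" "c \<in> atlas N"
  shows "open (coord c ` (U \<inter> chart_dom c))"
proof -
  have "smooth_map N U (tangent_bundle N) V" using assms(1) by (simp add: vector_field_on_def)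
  from smooth_mapD(3)[OF this assms(2), of "tangent_chart N c"] show ?thesis
    unfolding vector_field_on_chart_rep_dom[OF assms(1)] using assms(2) by simp
qed

lemma smooth_on_components:
  assumes "vector_field_on N U V" "c \<in> atlas N"
  shows "smooth_on (coord c ` (U \<inter> chart_dom c)) (components N c V)"
proof -
  have "smooth_map N U (tangent_bundle N) V" using assms(1) by (simp add: vector_field_on_def)
  from smooth_mapD(4)[OF this assms(2), of "tangent_chart N c"]
  have "smooth_on (coord c ` (U \<inter> chart_dom c)) (chart_rep c (tangent_chart N c) V)"
    unfolding vector_field_on_chart_rep_dom[OF assms(1)] using assms(2) by simp
  from smooth_on_linear_compose[OF bounded_linear_snd vector_field_on_open[OF assms] this]
  show ?thesis by (simp add: components_def[abs_def])
qed

section \<open>The Liouville field and its brackets\<close>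

lemma bounded_linear_coord_tangent_chart:
  assumes N: "smooth_atlas N" and c: "c \<in> atlas N" "p \<in> chart_dom c"
  shows "bounded_linear (\<lambda>v. snd (coord (tangent_chart N c) (p, v)))"
proof -
  have "p \<in> points N" by (rule chart_dom_points[OF N c])
  then have "(coord c \<circ> coord_inv (chart_at N p)) differentiable at (coord (chart_at N p) p)"
    by (intro transition_differentiable[OF N]) (simp_all add: smooth_atlas_simps[OF N] c)
  from has_derivative_bounded_linear[OF this[unfolded frechet_derivative_works]] show ?thesis
    by (simp add: coord_tangent_chart tangent_fun_Pair)
qed

text \<open>On one fibre the coordinate map is linear, so \<open>v + s v\<close> is a straight line
  in every induced chart; the foot point does not move, whence the entry 0.\<close>

lemma coord_liouville:
  assumes N: "smooth_atlas N" and c: "c \<in> atlas N" "fst \<xi> \<in> chart_dom c"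
  shows "coord (tangent_chart (tangent_bundle N) (tangent_chart N c)) (liouville N \<xi>) =
    (coord (tangent_chart N c) \<xi>, (0, snd (coord (tangent_chart N c) \<xi>)))"
proof -
  obtain p v where \<xi>: "\<xi> = (p, v)" by (cases \<xi>)
  let ?\<gamma> = "\<lambda>s. (p, v + s *\<^sub>R v)"
  let ?L = "\<lambda>v. snd (coord (tangent_chart N c) (p, v))"
  have L: "bounded_linear ?L" using bounded_linear_coord_tangent_chart[OF N] c \<xi> by simp
  have "((\<lambda>s. v + s *\<^sub>R v) has_vector_derivative v) (at 0)"
    by (auto intro!: derivative_eq_intros)
  from bounded_linear.has_vector_derivative[OF L this]
  have "((\<lambda>s. (coord c p, ?L (v + s *\<^sub>R v))) has_vector_derivative (0, ?L v)) (at 0)"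
    by (intro has_vector_derivative_Pair has_vector_derivative_const)
  moreover have "coord (tangent_chart N c) (?\<gamma> s) = (coord c p, ?L (v + s *\<^sub>R v))" for s
    by (simp add: prod_eq_iff)
  ultimately have "((\<lambda>s. coord (tangent_chart N c) (?\<gamma> s)) has_vector_derivative (0, ?L v)) (at 0)"
    by simp
  from coord_velocity[OF smooth_atlas_tangent_bundle[OF N] _ _ this] c show ?thesis
    by (simp add: liouville_def \<xi>)
qed

lemma components_liouville:
  assumes N: "smooth_atlas N" and c: "c \<in> atlas N" and z: "z \<in> coord c ` chart_dom c \<times> UNIV"
  shows "components (tangent_bundle N) (tangent_chart N c) (liouville N) z = (0, snd z)"
proof -
  note TN = smooth_atlas_tangent_bundle[OF N]
  have "z \<in> coord (tangent_chart N c) ` (chart_dom c \<times> UNIV)"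
    unfolding image_coord_tangent_chart[OF N c subset_refl] by (rule z)
  then obtain \<xi> where \<xi>: "z = coord (tangent_chart N c) \<xi>" "fst \<xi> \<in> chart_dom c"
    by auto
  then have "coord_inv (tangent_chart N c) z = \<xi>"
    using coord_inv_coord[OF TN, of "tangent_chart N c" \<xi>] c by (simp add: mem_Times_iff)
  then show ?thesis using coord_liouville[OF N c \<xi>(2)] \<xi>(1) by (simp add: components_def)
qed

text \<open>In coordinates the Liouville field is the linear map
  \<open>z \<mapsto> (0, snd z)\<close>, which is its own derivative; this gives the subtracted
  term. The preferred chart at \<open>(p, v)\<close> is the one induced by \<open>e\<close>, so the
  bracket is evaluated in that chart.\<close>

lemma lie_bracket_liouville:
  fixes V :: "'a \<times> 'e::euclidean_space \<Rightarrow> ('a \<times> 'e) \<times> ('e \<times> 'e)"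
  assumes N: "smooth_atlas N" and p: "p \<in> points N"
  defines "e \<equiv> chart_at N p"
  defines "w \<equiv> components (tangent_bundle N) (tangent_chart N e) V"
  shows "lie_bracket (tangent_bundle N) (liouville N) V (p, v) =
    ((p, v), frechet_derivative w (at (coord e p, v)) (0, v) - (0, snd (w (coord e p, v))))"
proof -
  have e: "e \<in> atlas N" "p \<in> chart_dom e" using p by (simp_all add: e_def smooth_atlas_simps[OF N])
  let ?l = "components (tangent_bundle N) (tangent_chart N e) (liouville N)"
  let ?z = "(coord e p, v)"
  have z: "?z \<in> coord e ` chart_dom e \<times> UNIV" using e by simp
  have "(?l has_derivative (\<lambda>h. (0, snd h))) (at ?z)"
  proof (rule has_derivative_transform_within_open[OF _ _ z])
    show "((\<lambda>z. (0, snd z)) has_derivative (\<lambda>h. (0, snd h))) (at ?z)"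
      by (auto intro!: derivative_eq_intros)
    show "open (coord e ` chart_dom e \<times> (UNIV :: 'e set))" using open_coord_dom[OF N e(1)] by (simp add: open_Times)
  qed (simp add: components_liouville[OF N e(1)])
  from fun_cong[OF frechet_derivative_at[OF this, symmetric]]
  show ?thesis
    using components_liouville[OF N e(1) z] p
    by (simp add: lie_bracket_def Let_def e_def[symmetric] w_def[symmetric])
      (simp add: e_def coord_tangent_chart_at[OF N])
qed

section \<open>Sprays and complete lifts in coordinates\<close>

lemma slit_tangent_bundle_iff: "\<xi> \<in> slit_tangent_bundle M \<longleftrightarrow> fst \<xi> \<in> points M \<and> snd \<xi> \<noteq> 0"
  by (cases \<xi>) (simp add: slit_tangent_bundle_def)

text \<open>\<open>flip\<close> moves the nonzero entry \<open>X\<close> into the fibre position, so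
  the complete lift evaluates \<open>S\<close> only inside its domain.\<close>

lemma slit_second_tangent_bundle_iff:
  "\<zeta> \<in> slit_second_tangent_bundle M \<longleftrightarrow> fst (flip \<zeta>) \<in> slit_tangent_bundle M"
  by (cases \<zeta>) (auto simp: slit_tangent_bundle_def slit_second_tangent_bundle_def flip_def)

lemma fst_fst_flip [simp]: "fst (fst (flip z)) = fst (fst z)"
  by (simp add: flip_def split_beta)

text \<open>
  The bracket condition refers to the preferred chart at the point; differentiating it requires its
  validity in a fixed chart around the point.
\<close>

lemma spray_homogeneous:
  assumes M: "smooth_atlas M" and S: "spray M (slit_tangent_bundle M) S" and c: "c \<in> atlas M"
    and \<xi>: "\<xi> \<in> slit_tangent_bundle M" "fst \<xi> \<in> chart_dom c"
  defines "w \<equiv> components (tangent_bundle M) (tangent_chart M c) S"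
    and "z \<equiv> coord (tangent_chart M c) \<xi>"
  shows "frechet_derivative w (at z) (0, snd z) - (0, snd (w z)) = w z"
proof -
  let ?T = "tangent_bundle M" and ?U = "slit_tangent_bundle M"
  note TM = smooth_atlas_tangent_bundle[OF M]
  have V: "vector_field_on ?T ?U S" using S by (simp add: spray_def semispray_def)
  obtain p y where py: "\<xi> = (p, y)" by (cases \<xi>)
  have p: "p \<in> points M" "p \<in> chart_dom c" using \<xi> py by (auto simp: slit_tangent_bundle_iff)
  let ?e = "chart_at M p"
  have e: "?e \<in> atlas M" "p \<in> chart_dom ?e" using p by (simp_all add: smooth_atlas_simps[OF M])
  let ?c = "tangent_chart M c" and ?d = "tangent_chart M ?e"
  let ?w = "components ?T ?d S"
  let ?f = "coord ?d \<circ> coord_inv ?c"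
  have cd: "?c \<in> atlas ?T" "?d \<in> atlas ?T" using c e by auto
  let ?A = "coord ?c ` (?U \<inter> chart_dom ?c) \<inter> coord ?c ` (chart_dom ?c \<inter> chart_dom ?d)"
  have A: "open ?A" "z \<in> ?A"
    using vector_field_on_open[OF V cd(1)] open_coord_Int[OF TM cd] \<xi> p e by (auto simp: z_def py)
  have inA: "\<exists>\<eta>\<in>?U. x = coord ?c \<eta> \<and> \<eta> \<in> chart_dom ?c \<and> \<eta> \<in> chart_dom ?d" if xA: "x \<in> ?A" for x
  proof -
    obtain \<eta> where \<eta>: "\<eta> \<in> ?U" "x = coord ?c \<eta>" "\<eta> \<in> chart_dom ?c" using xA by blast
    obtain \<eta>' where \<eta>': "x = coord ?c \<eta>'" "\<eta>' \<in> chart_dom ?c" "\<eta>' \<in> chart_dom ?d" using xA by blast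
    have "\<eta>' = \<eta>" using inj_onD[OF inj_on_coord[OF TM cd(1)]] \<eta> \<eta>' by metis
    then show ?thesis using \<eta> \<eta>' by blast
  qed
  have fz: "?f z = (coord ?e p, y)"
    using coord_inv_coord[OF TM cd(1), of \<xi>] p by (simp add: z_def py coord_tangent_chart_at[OF M])
  have f: "smooth_on ?A ?f" by (rule smooth_on_subset[OF smooth_on_transition[OF TM cd]]) blast
  have J: "((\<lambda>z. (0, snd z)) has_derivative (\<lambda>h. (0, snd h))) (at z)" for z :: "'b \<times> 'b"
    by (auto intro!: derivative_eq_intros)
  have w: "(w has_derivative frechet_derivative w (at z)) (at z)"
    unfolding w_def by (rule smooth_on_has_derivative[OF smooth_on_components[OF V cd(1)]]) (use A in blast)
  have "?f z \<in> coord ?d ` (?U \<inter> chart_dom ?d)"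
    unfolding fz coord_tangent_chart_at[OF M p(1), symmetric] using \<xi> py e by auto
  then have W: "(?w has_derivative frechet_derivative ?w (at (?f z))) (at (?f z))"
    by (rule smooth_on_has_derivative[OF smooth_on_components[OF V cd(2)]])
  have change: "tangent_fun ?f (coord (tangent_chart ?T ?c) \<theta>) = coord (tangent_chart ?T ?d) \<theta>"
    if "fst \<theta> \<in> chart_dom ?c" "fst \<theta> \<in> chart_dom ?d" for \<theta>
    using coord_tangent_chart_change[OF TM cd that] by simp
  \<comment> \<open>The component fields of \<open>S\<close> in the two charts are related by the
    transition \<open>?f\<close>; \<open>fC\<close> says the same of the Liouville field. These are
    the inputs for naturality of the bracket.\<close>
  have fS: "frechet_derivative ?f (at x) (w x) = ?w (?f x)" if xA: "x \<in> ?A" for x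
  proof -
    obtain \<eta> where \<eta>: "\<eta> \<in> ?U" "x = coord ?c \<eta>" "\<eta> \<in> chart_dom ?c" "\<eta> \<in> chart_dom ?d" using inA[OF xA] by blast
    have "fst (S \<eta>) = \<eta>" using V \<eta>(1) by (simp add: vector_field_on_def)
    then show ?thesis
      using change[of "S \<eta>"] \<eta>
      by (simp add: vector_field_on_coord[OF TM V] cd tangent_fun_Pair smooth_atlas_simps[OF TM] w_def
          del: chart_dom_tangent_chart atlas_tangent_bundle)
  qed
  have fC: "frechet_derivative ?f (at x) (0, snd x) = (0, snd (?f x))" if xA: "x \<in> ?A" for x
  proof -
    obtain \<eta> where \<eta>: "\<eta> \<in> ?U" "x = coord ?c \<eta>" "\<eta> \<in> chart_dom ?c" "\<eta> \<in> chart_dom ?d" using inA[OF xA] by blast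
    have dom: "fst \<eta> \<in> chart_dom c" "fst \<eta> \<in> chart_dom ?e" using \<eta> by auto
    have "fst (liouville M \<eta>) = \<eta>" by (simp add: liouville_def velocity_def)
    then show ?thesis
      using change[of "liouville M \<eta>"] \<eta> coord_inv_coord[OF TM cd(1) \<eta>(3)]
      by (simp add: coord_liouville[OF M c dom(1)] coord_liouville[OF M e(1) dom(2)] tangent_fun_Pair
          del: chart_dom_tangent_chart)
  qed
  \<comment> \<open>The bracket hypothesis is used here, at \<open>\<xi>\<close> itself, where the
    preferred chart is the one induced by \<open>?e\<close>.\<close>
  have hom: "frechet_derivative ?w (at (?f z)) (0, snd (?f z)) - (0, snd (?w (?f z))) = ?w (?f z)"
  proof -
    have "lie_bracket ?T (liouville M) S \<xi> = S \<xi>" using S \<xi> by (simp add: spray_def)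
    moreover have "S \<xi> = (\<xi>, ?w (?f z))"
    proof -
      have 1: "fst (S \<xi>) = \<xi>" using V \<xi>(1) by (simp add: vector_field_on_def)
      then have "coord (tangent_chart ?T ?d) (S \<xi>) = (coord ?d \<xi>, snd (S \<xi>))"
        using coord_second_tangent_chart_at[OF M p(1), of y "snd (S \<xi>)"] p
        by (metis coord_tangent_chart_at[OF M p(1)] prod.collapse py)
      then have "?w (coord ?d \<xi>) = snd (S \<xi>)"
        using vector_field_on_coord[OF TM V cd(2) \<xi>(1)] e py by simp
      moreover have "coord ?d \<xi> = ?f z" by (simp only: fz py coord_tangent_chart_at[OF M p(1)])
      ultimately show ?thesis using 1 by (metis prod.collapse)
    qed
    ultimately have "lie_bracket ?T (liouville M) S \<xi> = (\<xi>, ?w (?f z))" by simp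
    then show ?thesis
      unfolding fz py using lie_bracket_liouville[OF M p(1), of S y] by simp
  qed
  let ?D = "frechet_derivative ?f (at z)"
  have "?D (frechet_derivative w (at z) (0, snd z) - (0, snd (w z))) = ?w (?f z)"
    by (rule trans[OF bracket_natural[OF A f J w J W fC fS] hom])
  also have "\<dots> = ?D (w z)" using fS[OF A(2)] by simp
  finally have eq: "tangent_fun ?f (z, frechet_derivative w (at z) (0, snd z) - (0, snd (w z))) = tangent_fun ?f (z, w z)"
    by (simp add: tangent_fun_Pair)
  have dom: "\<xi> \<in> chart_dom ?c" "\<xi> \<in> chart_dom ?d" using p e py by auto
  \<comment> \<open>The reverse transition is a left inverse, so \<open>?D\<close> can be cancelled
    from the equation.\<close>
  have "tangent_fun (coord ?c \<circ> coord_inv ?d) (tangent_fun ?f (z, u)) = (z, u)" for u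
    using tangent_transition_compose[OF TM cd(1,2,1) dom(1,2,1), of "(z, u)"]
      tangent_transition_self[OF TM cd(1) dom(1), of "(z, u)"] by (simp add: z_def)
  then show ?thesis using eq by (metis prod.inject)
qed

text \<open>The first half of the lift satisfies the homogeneity of \<open>w\<close> at
  \<open>(x, X)\<close>. The second half satisfies its derivative in direction
  \<open>(y, Y)\<close>, once symmetry of second derivatives has exchanged \<open>(0, X)\<close> and
  \<open>(y, Y)\<close>.\<close>

lemma lifted_homogeneous:
  fixes w :: "'e::euclidean_space \<times> 'e \<Rightarrow> 'e \<times> 'e"
  assumes A: "open A" "fst (flip z) \<in> A" and w: "smooth_on A w"
    and hom: "\<And>x. x \<in> A \<Longrightarrow> frechet_derivative w (at x) (0, snd x) - (0, snd (w x)) = w x"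
  defines "w' \<equiv> \<lambda>z. flip (tangent_fun w (flip z))"
  shows "frechet_derivative w' (at z) (0, snd z) - (0, snd (w' z)) = w' z"
proof -
  obtain x y X Y where z: "z = ((x, y), (X, Y))" by (metis prod.collapse)
  let ?D = "frechet_derivative w (at (x, X))"
  let ?H = "\<lambda>u h. frechet_derivative (\<lambda>x. frechet_derivative w (at x) u) (at (x, X)) h"
  have xX: "(x, X) \<in> A" using A z by simp
  \<comment> \<open>Euler form of the bracket equation: the first entry of \<open>w\<close> has
    degree 1 in the fibre variable and the second has degree 2, one more than the bracket shows
    because of the subtracted term.\<close>
  define K :: "'e \<times> 'e \<Rightarrow> 'e \<times> 'e" where "K = (\<lambda>(a, b). (a, 2 *\<^sub>R b))"
  have K: "bounded_linear K"
  proof -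
    have "K = (\<lambda>z. (fst z, 2 *\<^sub>R snd z))" by (auto simp: K_def)
    then show ?thesis
      by (auto intro!: bounded_linear_Pair bounded_linear_fst bounded_linear_const_scaleR bounded_linear_snd)
  qed
  have homK: "frechet_derivative w (at x) (0, snd x) = K (w x)" if "x \<in> A" for x
  proof -
    have "frechet_derivative w (at x) (0, snd x) = w x + (0, snd (w x))"
      using hom[OF that] by (simp add: diff_eq_eq)
    then show ?thesis by (simp add: K_def split_beta prod_eq_iff scaleR_2)
  qed
  have J: "((\<lambda>z. (0, snd z)) has_derivative (\<lambda>h. (0, snd h))) (at (x, X))"
    by (auto intro!: derivative_eq_intros)
  have "((\<lambda>z. K (w z)) has_derivative (\<lambda>h. ?H (0, X) h + ?D (0, snd h))) (at (x, X))"
    using has_derivative_transform_within_open[OF has_derivative_derivative_apply[OF A(1) xX w J] A(1) xX homK]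
    by simp
  moreover have "((\<lambda>z. K (w z)) has_derivative (\<lambda>h. K (?D h))) (at (x, X))"
    by (rule bounded_linear.has_derivative[OF K smooth_on_has_derivative[OF w xX]])
  ultimately have "(\<lambda>h. ?H (0, X) h + ?D (0, snd h)) = (\<lambda>h. K (?D h))"
    by (rule has_derivative_unique)
  from fun_cong[OF this, of "(y, Y)"] have "?H (0, X) (y, Y) + ?D (0, Y) = K (?D (y, Y))" by simp
  then have e2: "?H (y, Y) (0, X) + ?D (0, Y) = K (?D (y, Y))"
    using second_derivative_symmetric[OF w A(1) xX, of "(0, X)" "(y, Y)"] by simp
  have e1: "?D (0, X) = K (w (x, X))" using homK[OF xX] by simp
  have "(tangent_fun w has_derivative frechet_derivative (tangent_fun w) (at (flip z))) (at (flip z))"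
    by (rule smooth_on_has_derivative[OF smooth_on_tangent_fun[OF A(1) w]]) (use xX z in simp)
  from diff_chain_at[OF bounded_linear_imp_has_derivative[OF bounded_linear_flip] this]
  have "(w' has_derivative (\<lambda>h. flip (frechet_derivative (tangent_fun w) (at (flip z)) (flip h)))) (at z)"
    unfolding w'_def by (auto intro!: bounded_linear.has_derivative[OF bounded_linear_flip] simp: o_def)
  \<comment> \<open>This is \<open>(0, snd z)\<close>. Its flip \<open>((0, X), (0, Y))\<close> is
    fed to the derivative of \<open>tangent_fun w\<close>, whose two entries are then evaluated by
    \<open>e1\<close> and \<open>e2\<close>.\<close>
  from fun_cong[OF frechet_derivative_at[OF this, symmetric], of "((0, 0), (X, Y))"]
  have "frechet_derivative w' (at z) (0, snd z) = flip (K (w (x, X)), K (?D (y, Y)))"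
    by (simp add: z frechet_derivative_tangent_fun[OF A(1) w xX] e1 e2 zero_prod_def)
  moreover have "w' z = flip (w (x, X), ?D (y, Y))" by (simp add: w'_def z tangent_fun_Pair)
  ultimately show ?thesis
    by (cases "w (x, X)"; cases "?D (y, Y)") (simp add: K_def scaleR_2)
qed

section \<open>The complete lift in coordinates\<close>

text \<open>In the chart, \<open>S\<close> is \<open>x \<mapsto> (x, w x)\<close>, and its tangent
  map at \<open>flip z\<close> is \<open>flip (flip z, T w (flip z))\<close>. Applying
  \<open>\<kappa>\<^sub>3\<close> removes the outer flip, and \<open>D \<kappa>\<^sub>2\<close>
  flips both entries. The second conclusion locates the lifted vector over the same point, which is
  what injectivity of a chart needs before coordinates can be compared.\<close>

lemma coord_complete_lift:
  assumes M: "smooth_atlas M" and V: "vector_field_on (tangent_bundle M) (slit_tangent_bundle M) S"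
    and c: "c \<in> atlas M" and \<zeta>: "\<zeta> \<in> slit_second_tangent_bundle M" "fst (fst \<zeta>) \<in> chart_dom c"
  defines "w \<equiv> components (tangent_bundle M) (tangent_chart M c) S"
    and "z \<equiv> coord (tangent_chart (tangent_bundle M) (tangent_chart M c)) \<zeta>"
  shows "coord (tangent_chart (tangent_bundle (tangent_bundle M)) (tangent_chart (tangent_bundle M) (tangent_chart M c)))
      (complete_lift M S \<zeta>) = (z, flip (tangent_fun w (flip z)))"
    and "fst (fst (fst (complete_lift M S \<zeta>))) = fst (fst \<zeta>)"
proof -
  let ?T = "tangent_bundle M" and ?U = "slit_tangent_bundle M"
  let ?TT = "tangent_bundle ?T"
  let ?c = "tangent_chart M c"
  let ?cc = "tangent_chart ?T ?c"
  let ?ccc = "tangent_chart ?TT ?cc"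
  note TM = smooth_atlas_tangent_bundle[OF M]
  note TTM = smooth_atlas_tangent_bundle[OF TM]
  have cs: "?c \<in> atlas ?T" "?cc \<in> atlas ?TT" using c by auto
  have smS: "smooth_map ?T ?U ?TT S" using V by (simp add: vector_field_on_def)
  define \<eta> where "\<eta> = flip \<zeta>"
  define \<theta> where "\<theta> = tangent_map ?T ?TT S \<eta>"
  have pc: "fst (fst \<zeta>) \<in> points M" using chart_dom_points[OF M c \<zeta>(2)] .
  have "\<zeta> \<in> points ?TT" using pc by (simp add: mem_Times_iff)
  then have k2: "canonical_flip M \<zeta> = \<eta>" unfolding \<eta>_def by (rule canonical_flip_eq_flip[OF M])
  have \<eta>: "fst \<eta> \<in> ?U" "fst (fst \<eta>) = fst (fst \<zeta>)"
    using \<zeta> by (simp_all add: \<eta>_def slit_second_tangent_bundle_iff)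
  have \<eta>c: "fst \<eta> \<in> chart_dom ?c" using \<eta> \<zeta> by (simp add: mem_Times_iff)
  have f\<theta>: "fst \<theta> = S (fst \<eta>)" by (simp add: \<theta>_def tangent_map_def split_beta)
  have fS: "fst (S (fst \<eta>)) = fst \<eta>" using V \<eta>(1) by (simp add: vector_field_on_def)
  have "fst (fst (fst \<theta>)) \<in> points M" using f\<theta> fS \<eta> pc by simp
  then have "\<theta> \<in> points (tangent_bundle ?TT)" by (simp add: mem_Times_iff)
  then have k3: "canonical_flip ?T \<theta> = flip \<theta>" by (rule canonical_flip_eq_flip[OF TM])
  have S_eq: "complete_lift M S \<zeta> = tangent_map ?TT ?TT (canonical_flip M) (flip \<theta>)"
    by (simp add: complete_lift_def Let_def k2 \<theta>_def[symmetric] k3)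
  have base: "fst (fst (fst (flip \<theta>))) = fst (fst \<zeta>)" using f\<theta> fS \<eta> by simp
  then have "fst (flip \<theta>) \<in> points ?TT" using pc by (simp add: mem_Times_iff)
  then have k: "canonical_flip M (fst (flip \<theta>)) = flip (fst (flip \<theta>))" by (rule canonical_flip_eq_flip[OF M])
  have "fst (complete_lift M S \<zeta>) = flip (fst (flip \<theta>))"
    unfolding S_eq k[symmetric] by (simp add: tangent_map_def split_beta)
  then show "fst (fst (fst (complete_lift M S \<zeta>))) = fst (fst \<zeta>)" using base by simp

  let ?A = "coord ?c ` (?U \<inter> chart_dom ?c)"
  have A: "open ?A" "coord ?c (fst \<eta>) \<in> ?A" using vector_field_on_open[OF V cs(1)] \<eta> \<eta>c by blast+
  have sw: "smooth_on ?A w" unfolding w_def by (rule smooth_on_components[OF V cs(1)])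
  have c\<eta>: "coord ?cc \<eta> = flip z"
    unfolding \<eta>_def z_def by (rule coord_flip[OF M c \<zeta>(2)])
  then have f\<eta>: "coord ?c (fst \<eta>) = fst (flip z)" by (metis fst_coord_tangent_chart)
  have fzA: "fst (flip z) \<in> ?A" using A(2) f\<eta> by simp
  have "coord ?ccc \<theta> = tangent_fun (chart_rep ?c ?cc S) (flip z)"
    unfolding \<theta>_def c\<eta>[symmetric]
    by (rule coord_tangent_map[OF TM TTM smS cs \<eta>(1) \<eta>c]) (use fS \<eta>c in \<open>simp add: mem_Times_iff\<close>)
  also have "\<dots> = tangent_fun (\<lambda>x. (x, w x)) (flip z)"
  proof (rule tangent_fun_cong[OF A(1) fzA, symmetric])
    show "(\<lambda>x. (x, w x)) differentiable at (fst (flip z))"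
      by (rule Derivative.differentiableI[OF has_derivative_Pair[OF has_derivative_ident smooth_on_has_derivative[OF sw fzA]]])
    fix x assume "x \<in> ?A"
    then obtain \<xi> where "x = coord ?c \<xi>" "\<xi> \<in> ?U" "\<xi> \<in> chart_dom ?c" by blast
    then show "(x, w x) = chart_rep ?c ?cc S x"
      using vector_field_on_coord[OF TM V cs(1), of \<xi>] coord_inv_coord[OF TM cs(1), of \<xi>] by (simp add: w_def)
  qed
  also have "\<dots> = flip (flip z, tangent_fun w (flip z))"
  proof -
    have "((\<lambda>x. (x, w x)) has_derivative (\<lambda>h. (h, frechet_derivative w (at (fst (flip z))) h))) (at (fst (flip z)))"
      by (intro has_derivative_Pair has_derivative_ident smooth_on_has_derivative[OF sw fzA])
    from frechet_derivative_at[OF this, symmetric] show ?thesis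
      by (simp add: tangent_fun_def split_beta flip_def)
  qed
  finally have c\<theta>: "coord ?ccc \<theta> = flip (flip z, tangent_fun w (flip z))" .
  have "fst (fst \<theta>) \<in> chart_dom ?c" using f\<theta> fS \<eta>c by simp
  from coord_flip[OF TM cs(1) this] have cf\<theta>: "coord ?ccc (flip \<theta>) = (flip z, tangent_fun w (flip z))"
    by (simp add: c\<theta>)
  have smk: "smooth_map ?TT (points ?TT) ?TT (canonical_flip M)"
    by (rule smooth_map_cong[OF TTM smooth_map_flip[OF M]]) (simp add: canonical_flip_eq_flip[OF M])
  have dom: "fst (flip \<theta>) \<in> chart_dom ?cc" using base \<zeta> by (simp add: mem_Times_iff)
  have "coord ?ccc (complete_lift M S \<zeta>) = tangent_fun (chart_rep ?cc ?cc (canonical_flip M)) (flip z, tangent_fun w (flip z))"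
    unfolding S_eq cf\<theta>[symmetric]
    by (rule coord_tangent_map[OF TTM TTM smk cs(2) cs(2)])
      (use dom base \<zeta> pc in \<open>simp_all add: mem_Times_iff k\<close>)
  \<comment> \<open>\<open>canonical_flip M\<close> is known to be \<open>flip\<close> on the
    bundle. The chart image is an open set of coordinates of such points, which suffices to replace
    it under the tangent map.\<close>
  also have "\<dots> = tangent_fun flip (flip z, tangent_fun w (flip z))"
  proof (rule tangent_fun_cong[OF open_coord_dom[OF TTM cs(2)], symmetric])
    show "fst (flip z, tangent_fun w (flip z)) \<in> coord ?cc ` chart_dom ?cc"
      using dom cf\<theta> by (metis fst_coord_tangent_chart imageI)
    show "flip differentiable at (fst (flip z, tangent_fun w (flip z)))"
      by (rule bounded_linear_imp_differentiable[OF bounded_linear_flip])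
    fix x assume "x \<in> coord ?cc ` chart_dom ?cc"
    then obtain \<xi> where \<xi>: "x = coord ?cc \<xi>" "\<xi> \<in> chart_dom ?cc" by blast
    then have d: "fst (fst \<xi>) \<in> chart_dom c" by auto
    have "\<xi> \<in> points ?TT" using chart_dom_points[OF TTM cs(2) \<xi>(2)] .
    then show "flip x = chart_rep ?cc ?cc (canonical_flip M) x"
      using coord_flip[OF M c d] coord_inv_coord[OF TTM cs(2) \<xi>(2)] canonical_flip_eq_flip[OF M] \<xi>(1) by simp
  qed
  finally show "coord ?ccc (complete_lift M S \<zeta>) = (z, flip (tangent_fun w (flip z)))"
    by (simp add: tangent_fun_flip)
qed

theorem proposition5p4:
  fixes M :: "('a, 'e::euclidean_space) manifold"
    and S :: "'a \<times> 'e \<Rightarrow> ('a \<times> 'e) \<times> ('e \<times> 'e)"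
  assumes "smooth_manifold M"
    and "spray M (slit_tangent_bundle M) S"
  shows "spray (tangent_bundle M) (slit_second_tangent_bundle M) (complete_lift M S)"
proof -
  let ?T = "tangent_bundle M" and ?U = "slit_tangent_bundle M" and ?U2 = "slit_second_tangent_bundle M"
  let ?TT = "tangent_bundle ?T" and ?S = "complete_lift M S"
  let ?TTT = "tangent_bundle ?TT"
  let ?w = "\<lambda>c. components ?T (tangent_chart M c) S"
  let ?w' = "\<lambda>c z. flip (tangent_fun (?w c) (flip z))"
  let ?c2 = "\<lambda>c. tangent_chart ?T (tangent_chart M c)"
  let ?c3 = "\<lambda>c. tangent_chart ?TT (?c2 c)"
  note S = assms(2)
  have M: "smooth_atlas M" by (rule smooth_manifold_imp_smooth_atlas[OF assms(1)])
  note TM = smooth_atlas_tangent_bundle[OF M]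
  note TTM = smooth_atlas_tangent_bundle[OF TM]
  note TTTM = smooth_atlas_tangent_bundle[OF TTM]
  have V: "vector_field_on ?T ?U S" and kS: "\<And>\<xi>. \<xi> \<in> ?U \<Longrightarrow> canonical_flip M (S \<xi>) = S \<xi>"
    using S by (simp_all add: spray_def semispray_def)
  have pts: "fst (fst \<zeta>) \<in> points M" if "\<zeta> \<in> ?U2" for \<zeta>
    using that by (simp add: slit_second_tangent_bundle_iff slit_tangent_bundle_iff)
  note coord_S = coord_complete_lift[OF M V]
  \<comment> \<open>The coordinate formula gives the foot point of the lift the coordinates of
    \<open>\<zeta>\<close>; the second part of \<open>coord_S\<close> puts it into the chart domain,
    so that injectivity applies.\<close>
  have fst_S: "fst (?S \<zeta>) = \<zeta>" if \<zeta>: "\<zeta> \<in> ?U2" for \<zeta>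
  proof -
    let ?c = "chart_at M (fst (fst \<zeta>))"
    have c: "?c \<in> atlas M" "fst (fst \<zeta>) \<in> chart_dom ?c"
      using pts[OF \<zeta>] by (simp_all add: smooth_atlas_simps[OF M])
    have c2: "?c2 ?c \<in> atlas ?TT" using c by auto
    have "fst (coord (?c3 ?c) (?S \<zeta>)) = coord (?c2 ?c) \<zeta>"
      unfolding coord_S(1)[OF c(1) \<zeta> c(2)] by simp
    then have "coord (?c2 ?c) (fst (?S \<zeta>)) = coord (?c2 ?c) \<zeta>" by simp
    then show ?thesis
      by (rule inj_onD[OF inj_on_coord[OF TTM c2]])
        (use c coord_S(2)[OF c(1) \<zeta> c(2)] in \<open>simp_all add: mem_Times_iff\<close>)
  qed
  \<comment> \<open>The coordinates of those points of \<open>?U2\<close> that lie over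
    \<open>c\<close>, as \<open>in_B\<close> and \<open>B_ex\<close> confirm. Written as a preimage
    under \<open>flip\<close>, the set is seen to be open.\<close>
  define B :: "('a, 'e) chart \<Rightarrow> (('e \<times> 'e) \<times> ('e \<times> 'e)) set" where "B c = flip -` (coord (tangent_chart M c) ` (?U \<inter> chart_dom (tangent_chart M c)) \<times> UNIV)" for c
  have oA: "open (coord (tangent_chart M c) ` (?U \<inter> chart_dom (tangent_chart M c)))" if "c \<in> atlas M" for c
    by (rule vector_field_on_open[OF V]) (use that in simp)
  have sw: "smooth_on (coord (tangent_chart M c) ` (?U \<inter> chart_dom (tangent_chart M c))) (?w c)"
    if "c \<in> atlas M" for c
    by (rule smooth_on_components[OF V]) (use that in simp)
  have oB: "open (B c)" if "c \<in> atlas M" for c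
    unfolding B_def
    by (rule open_vimage) (use oA[OF that] linear_continuous_on[OF bounded_linear_flip] in \<open>auto simp: open_Times\<close>)
  have sw': "smooth_on (B c) (?w' c)" if c: "c \<in> atlas M" for c
  proof (rule smooth_on_linear_compose[OF bounded_linear_flip oB[OF c]])
    show "smooth_on (B c) (\<lambda>z. tangent_fun (?w c) (flip z))"
      by (rule smooth_on_compose[OF oB[OF c] _ _ smooth_on_linear[OF bounded_linear_flip oB[OF c]]
            smooth_on_tangent_fun[OF oA[OF c] sw[OF c]]])
        (use oA[OF c] in \<open>auto simp: open_Times B_def\<close>)
  qed
  have in_B: "coord (?c2 c) \<zeta> \<in> B c" if "c \<in> atlas M" "\<zeta> \<in> ?U2" "fst (fst \<zeta>) \<in> chart_dom c" for c \<zeta>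
  proof -
    have "fst (flip (coord (?c2 c) \<zeta>)) = coord (tangent_chart M c) (fst (flip \<zeta>))"
      unfolding coord_flip[OF M that(1,3), symmetric] by simp
    moreover have "fst (flip \<zeta>) \<in> ?U \<inter> chart_dom (tangent_chart M c)"
      using that by (simp add: slit_second_tangent_bundle_iff mem_Times_iff)
    ultimately show ?thesis by (simp add: B_def mem_Times_iff)
  qed
  have B_ex: "\<exists>\<zeta>\<in>?U2. z = coord (?c2 c) \<zeta> \<and> \<zeta> \<in> chart_dom (?c2 c)" if c: "c \<in> atlas M" and z: "z \<in> B c" for c z
  proof -
    obtain \<xi> where \<xi>: "fst (flip z) = coord (tangent_chart M c) \<xi>" "\<xi> \<in> ?U" "fst \<xi> \<in> chart_dom c"
      using z by (auto simp: B_def)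
    have "fst (fst z) \<in> coord c ` chart_dom c"
      using arg_cong[OF \<xi>(1), of fst] \<xi>(3) by simp
    then have "z \<in> (coord c ` chart_dom c \<times> UNIV) \<times> UNIV" by (simp add: mem_Times_iff)
    also have "\<dots> = coord (?c2 c) ` chart_dom (?c2 c)"
      using image_coord_tangent_chart[OF TM, of "tangent_chart M c" "chart_dom c \<times> UNIV"]
        image_coord_tangent_chart[OF M c subset_refl] c by simp
    finally obtain \<zeta> where \<zeta>: "z = coord (?c2 c) \<zeta>" "\<zeta> \<in> chart_dom (?c2 c)" by blast
    then have dom: "fst (fst \<zeta>) \<in> chart_dom c" by (simp add: mem_Times_iff)
    then have "coord (tangent_chart M c) (fst (flip \<zeta>)) = coord (tangent_chart M c) \<xi>"
      using \<xi>(1) unfolding \<zeta>(1) coord_flip[OF M c dom, symmetric] by simp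
    then have "fst (flip \<zeta>) = \<xi>"
      by (rule inj_onD[OF inj_on_coord_tangent_chart[OF M c]]) (use dom \<xi> in \<open>simp_all add: mem_Times_iff\<close>)
    then have "\<zeta> \<in> ?U2" using \<xi> by (simp add: slit_second_tangent_bundle_iff)
    then show ?thesis using \<zeta> by blast
  qed
  have rep: "chart_rep (?c2 c) (?c3 c) ?S z = (z, ?w' c z)" if c: "c \<in> atlas M" and z: "z \<in> B c" for c z
  proof -
    obtain \<zeta> where \<zeta>: "\<zeta> \<in> ?U2" "z = coord (?c2 c) \<zeta>" "\<zeta> \<in> chart_dom (?c2 c)" using B_ex[OF c z] by blast
    have dom: "fst (fst \<zeta>) \<in> chart_dom c" using \<zeta>(3) by (simp add: mem_Times_iff)
    have "coord_inv (?c2 c) z = \<zeta>" unfolding \<zeta>(2) by (rule coord_inv_coord[OF TTM _ \<zeta>(3)]) (use c in simp)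
    then show ?thesis using coord_S(1)[OF c \<zeta>(1) dom] \<zeta>(2) by simp
  qed
  have vf: "vector_field_on ?TT ?U2 ?S"
    unfolding vector_field_on_def
  proof (intro conjI ballI fst_S smooth_mapI_local[OF TTM TTTM])
    show "?U2 \<subseteq> points ?TT" using pts by (auto simp: mem_Times_iff)
    fix \<zeta> assume \<zeta>: "\<zeta> \<in> ?U2"
    let ?c = "chart_at M (fst (fst \<zeta>))"
    have c: "?c \<in> atlas M" "fst (fst \<zeta>) \<in> chart_dom ?c"
      using pts[OF \<zeta>] by (simp_all add: smooth_atlas_simps[OF M])
    have "smooth_on (B ?c) (\<lambda>z. (z, ?w' ?c z))"
      by (intro smooth_on_Pair oB c sw' smooth_on_linear[OF bounded_linear_ident])
    then have "smooth_on (B ?c) (chart_rep (?c2 ?c) (?c3 ?c) ?S)"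
      by (rule smooth_on_cong[OF oB[OF c(1)], rotated]) (simp only: rep[OF c(1)])
    moreover have "B ?c \<subseteq> chart_rep_dom (?c2 ?c) (?c3 ?c) ?U2 ?S"
    proof
      fix z assume "z \<in> B ?c"
      then obtain \<eta> where \<eta>: "\<eta> \<in> ?U2" "z = coord (?c2 ?c) \<eta>" "\<eta> \<in> chart_dom (?c2 ?c)"
        using B_ex[OF c(1)] by blast
      then have "?S \<eta> \<in> chart_dom (?c3 ?c)" using fst_S by (simp add: mem_Times_iff)
      then show "z \<in> chart_rep_dom (?c2 ?c) (?c3 ?c) ?U2 ?S" using \<eta> by blast
    qed
    moreover have "?c2 ?c \<in> atlas ?TT" "?c3 ?c \<in> atlas ?TTT" using c by auto
    moreover have "\<zeta> \<in> chart_dom (?c2 ?c)" using c by (simp add: mem_Times_iff)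
    ultimately show "\<exists>c\<in>atlas ?TT. \<exists>d\<in>atlas ?TTT. \<exists>W. open W \<and> \<zeta> \<in> chart_dom c \<and> coord c \<zeta> \<in> W \<and>
        W \<subseteq> chart_rep_dom c d ?U2 ?S \<and> smooth_on W (chart_rep c d ?S)"
      using oB[OF c(1)] in_B[OF c(1) \<zeta> c(2)] by blast
  qed
  \<comment> \<open>Coordinate form of the semispray condition, read off from a point
    \<open>(x, w x)\<close> fixed by \<open>flip\<close>.\<close>
  have w_fst: "fst (?w c x) = snd x"
    if c: "c \<in> atlas M" and x: "x \<in> coord (tangent_chart M c) ` (?U \<inter> chart_dom (tangent_chart M c))" for c x
  proof -
    obtain \<xi> where \<xi>: "x = coord (tangent_chart M c) \<xi>" "\<xi> \<in> ?U" "\<xi> \<in> chart_dom (tangent_chart M c)"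
      using x by blast
    have cT: "tangent_chart M c \<in> atlas ?T" using c by simp
    have S\<xi>: "fst (S \<xi>) = \<xi>" using V \<xi>(2) by (simp add: vector_field_on_def)
    then have "S \<xi> \<in> points ?TT" using \<xi>(2) by (simp add: mem_Times_iff slit_tangent_bundle_iff)
    from canonical_flip_eq_flip[OF M this] have flip_S: "flip (S \<xi>) = S \<xi>" unfolding kS[OF \<xi>(2)] by (rule sym)
    have "fst (fst (S \<xi>)) \<in> chart_dom c" using S\<xi> \<xi>(3) by (simp add: mem_Times_iff)
    from coord_flip[OF M c this, unfolded flip_S vector_field_on_coord[OF TM V cT \<xi>(2,3)]]
    have "(x, ?w c x) = flip (x, ?w c x)" unfolding \<xi>(1)[symmetric] .
    then have "fst (x, ?w c x) = fst (flip (x, ?w c x))" by (rule arg_cong)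
    then have "snd x = snd (fst (flip (x, ?w c x)))" by (metis fst_conv)
    then show ?thesis by (simp add: flip_def split_beta)
  qed
  \<comment> \<open>For \<open>z = ((x, y), (X, Y))\<close> the halves of \<open>fst (w' z)\<close>
    are \<open>fst (w (x, X)) = X\<close> and \<open>fst (D w (x, X) (y, Y)) = Y\<close>. The second
    is the derivative of the first, which holds on an open set.\<close>
  have w'_fst: "fst (?w' c z) = snd z" if c: "c \<in> atlas M" and z: "z \<in> B c" for c z
  proof -
    obtain z1 z2 where z12: "flip z = (z1, z2)" by (cases "flip z")
    let ?A = "coord (tangent_chart M c) ` (?U \<inter> chart_dom (tangent_chart M c))"
    have A: "z1 \<in> ?A" using z z12 by (simp add: B_def)
    have "((\<lambda>x. fst (?w c x)) has_derivative (\<lambda>h. fst (frechet_derivative (?w c) (at z1) h))) (at z1)"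
      by (rule bounded_linear.has_derivative[OF bounded_linear_fst smooth_on_has_derivative[OF sw[OF c] A]])
    moreover have "((\<lambda>x. fst (?w c x)) has_derivative snd) (at z1)"
      by (rule has_derivative_transform_within_open[OF bounded_linear_imp_has_derivative[OF bounded_linear_snd]
            oA[OF c] A]) (simp only: w_fst[OF c])
    ultimately have "(\<lambda>h. fst (frechet_derivative (?w c) (at z1) h)) = snd"
      by (rule has_derivative_unique)
    from fun_cong[OF this] have "fst (frechet_derivative (?w c) (at z1) z2) = snd z2" .
    moreover have "fst (?w c z1) = snd z1" by (rule w_fst[OF c A])
    moreover have "z = flip (z1, z2)" using z12 by (metis flip_flip)
    ultimately show ?thesis by (simp add: z12 tangent_fun_Pair) (simp add: flip_def split_beta)
  qed
  have semi: "semispray ?T ?U2 ?S"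
    unfolding semispray_def
  proof (intro conjI vf ballI)
    fix \<zeta> assume \<zeta>: "\<zeta> \<in> ?U2"
    let ?c = "chart_at M (fst (fst \<zeta>))"
    have c: "?c \<in> atlas M" "fst (fst \<zeta>) \<in> chart_dom ?c"
      using pts[OF \<zeta>] by (simp_all add: smooth_atlas_simps[OF M])
    have Tc: "tangent_chart M ?c \<in> atlas ?T" "?c2 ?c \<in> atlas ?TT" using c by auto
    have dom: "fst (fst (?S \<zeta>)) \<in> chart_dom (tangent_chart M ?c)"
      unfolding fst_S[OF \<zeta>] using c by (simp add: mem_Times_iff)
    have "?S \<zeta> \<in> points ?TTT" using fst_S[OF \<zeta>] pts[OF \<zeta>] by (simp add: mem_Times_iff)
    then have "canonical_flip ?T (?S \<zeta>) = flip (?S \<zeta>)" by (rule canonical_flip_eq_flip[OF TM])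
    \<comment> \<open>\<open>w'_fst\<close> is the criterion for \<open>(z, w' z)\<close> to be
      fixed by the flip of coordinates; injectivity of the chart carries this back to the
      lift.\<close>
    moreover have "coord (?c3 ?c) (flip (?S \<zeta>)) = coord (?c3 ?c) (?S \<zeta>)"
      unfolding coord_flip[OF TM Tc(1) dom] coord_S(1)[OF c(1) \<zeta> c(2)]
      by (rule flip_Pair_eq) (rule w'_fst[OF c(1) in_B[OF c(1) \<zeta> c(2)]])
    then have "flip (?S \<zeta>) = ?S \<zeta>"
      by (rule inj_onD[OF inj_on_coord_tangent_chart[OF TTM Tc(2)]]) (use dom in \<open>simp_all add: mem_Times_iff\<close>)
    ultimately show "canonical_flip ?T (?S \<zeta>) = ?S \<zeta>" by simp
  qed
  show ?thesis
    unfolding spray_def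
  proof (intro conjI semi ballI)
    fix \<zeta> assume \<zeta>: "\<zeta> \<in> ?U2"
    obtain p y Z where \<zeta>_eq: "\<zeta> = ((p, y), Z)" by (metis prod.collapse)
    have p: "p \<in> points M" using pts[OF \<zeta>] \<zeta>_eq by simp
    let ?c = "chart_at M p"
    have c: "?c \<in> atlas M" "fst (fst \<zeta>) \<in> chart_dom ?c" using p by (simp_all add: \<zeta>_eq smooth_atlas_simps[OF M])
    have py: "(p, y) \<in> points ?T" using p by simp
    define z where "z = ((coord ?c p, y), Z)"
    have z: "coord (?c2 ?c) \<zeta> = z" by (simp add: \<zeta>_eq z_def coord_second_tangent_chart_at[OF M p])
    have zB: "z \<in> B ?c" using in_B[OF c(1) \<zeta> c(2)] z by simp
    let ?C = "components ?TT (?c2 ?c) ?S"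
    have C: "?C x = ?w' ?c x" if "x \<in> B ?c" for x
      using rep[OF c(1) that] by (simp add: components_def)
    have DC: "frechet_derivative ?C (at z) = frechet_derivative (?w' ?c) (at z)"
      by (rule frechet_derivative_transform_within_open[OF _ oB[OF c(1)] zB, symmetric])
        (simp_all only: C smooth_on_differentiable[OF sw'[OF c(1)] zB])
    \<comment> \<open>The homogeneity of \<open>S\<close> is supplied at every point of an open set
      in the one chart induced by \<open>?c\<close>, since \<open>lifted_homogeneous\<close>
      differentiates it.\<close>
    have "frechet_derivative (?w' ?c) (at z) (0, snd z) - (0, snd (?w' ?c z)) = ?w' ?c z"
    proof (rule lifted_homogeneous[OF oA[OF c(1)] _ sw[OF c(1)]])
      show "fst (flip z) \<in> coord (tangent_chart M ?c) ` (?U \<inter> chart_dom (tangent_chart M ?c))"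
        using zB by (simp add: B_def mem_Times_iff)
      fix x assume "x \<in> coord (tangent_chart M ?c) ` (?U \<inter> chart_dom (tangent_chart M ?c))"
      then obtain \<xi> where "x = coord (tangent_chart M ?c) \<xi>" "\<xi> \<in> ?U" "fst \<xi> \<in> chart_dom ?c" by auto
      then show "frechet_derivative (?w ?c) (at x) (0, snd x) - (0, snd (?w ?c x)) = ?w ?c x"
        using spray_homogeneous[OF M S c(1)] by blast
    qed
    then have "lie_bracket ?TT (liouville ?T) ?S \<zeta> = (\<zeta>, ?w' ?c z)"
      using lie_bracket_liouville[OF TM py, of ?S Z] C[OF zB] DC
      by (simp add: \<zeta>_eq coord_tangent_chart_at[OF M p] z_def[symmetric]) (simp add: z_def)
    \<comment> \<open>In the preferred chart at \<open>\<zeta>\<close> the fibre coordinate is the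
      encoded vector, so the coordinate formula is already an equation between points.\<close>
    moreover have "?S \<zeta> = (\<zeta>, ?w' ?c z)"
    proof -
      have "?S \<zeta> = ((( p, y), Z), snd (?S \<zeta>))" using fst_S[OF \<zeta>] \<zeta>_eq by (metis prod.collapse)
      moreover have "coord (?c3 ?c) (((p, y), Z), u) = (z, u)" for u
        using coord_second_tangent_chart_at[OF TM py, of Z u]
        by (simp add: coord_tangent_chart_at[OF M p] z_def)
      ultimately have "(z, snd (?S \<zeta>)) = (z, ?w' ?c z)"
        using coord_S(1)[OF c(1) \<zeta> c(2)] z by metis
      then show ?thesis using fst_S[OF \<zeta>] by (simp add: prod_eq_iff)
    qed
    ultimately show "lie_bracket ?TT (liouville ?T) ?S \<zeta> = ?S \<zeta>" by simp
  qed
qed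

end
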